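(* Let $d\ge 1$, let $\Omega\subset\mathbb{R}^d$ be a bounded open set, let $\theta\in\mathbb{S}^{d-1}$ and let $u\in W_\theta(\Omega)$. Then there exists a directional trace $g:\partial\Omega\to\mathbb{R}$ of $u$ in the direction $\theta$ which moreover is measurable for the Borel $\sigma$-algebra.
   Context: $\partial\Omega=\overline{\Omega}\setminus\Omega$; $\mathbb{S}^{d-1}$ is the Euclidean unit sphere of $\mathbb{R}^d$; $]a,b[$ denotes the open real interval. No regularity of $\Omega$ is assumed. A function $u\in L^2(\Omega)$ has weak directional derivative $\partial_\theta u=v\in L^2(\Omega)$ if $\int_\Omega u\,(\theta\cdot\nabla\varphi)\,dx=-\int_\Omega v\varphi\,dx$ for all $\varphi\in C^\infty_c(\Omega)$. $W_\theta(\Omega)=\{u\in L^2(\Omega):\partial_\theta u\in L^2(\Omega)\}$. $H_\theta=\{y\in\mathbb{R}^d: y\cdot\theta=0\}$; $\mathcal{P}_\theta(x)=x-(x\cdot\theta)\theta$ is the orthogonal projection onto $H_\theta$; $\lambda^{d-1}$ is the $(d-1)$-dimensional Lebesgue measure on $H_\theta$ (identified isometrically with $\mathbb{R}^{d-1}$). For $y\in H_\theta$, $\omega_\theta(y)=\{s\in\mathbb{R}: s\theta+y\in\Omega\}$, an open subset of $\mathbb{R}$, and $\mathcal{I}_\theta(y)$ is the countable set of disjoint bounded open intervals (the connected components) whose union is $\omega_\theta(y)$. Directional trace: a function $g:\partial\Omega\to\mathbb{R}$ is a directional trace of $u\in W_\theta(\Omega)$ in the direction $\theta$ if there exist a representative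 of $u$ (still denoted $u$) and a set $A\subset\mathcal{P}_\theta(\Omega)$ such that (1) $\mathcal{P}_\theta(\Omega)\setminus A$ is $\lambda^{d-1}$-negligible; (2) for all $y\in A$, $u_{\theta,y}:s\mapsto u(s\theta+y)$ is an element of $H^1(\omega_\theta(y))$ and, for all $]\alpha,\beta[\,\in\mathcal{I}_\theta(y)$, taking the representative of $u_{\theta,y}$ which is continuous on $]\alpha,\beta]$, one has $g(\beta\theta+y)=u_{\theta,y}(\beta)$. *)

theory Defs
  imports "HOL-Analysis.Analysis"
begin

definition partial_deriv :: "'a::euclidean_space \<Rightarrow> ('a \<Rightarrow> real) \<Rightarrow> 'a \<Rightarrow> real" where
  "partial_deriv b f x = frechet_derivative f (at x) b"

definition gradient :: "('a::euclidean_space \<Rightarrow> real) \<Rightarrow> 'a \<Rightarrow> 'a" where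
  "gradient f x = (\<Sum>b\<in>Basis. partial_deriv b f x *\<^sub>R b)"

primrec C_k :: "nat \<Rightarrow> ('a::euclidean_space \<Rightarrow> real) \<Rightarrow> bool" where
  "C_k 0 f \<longleftrightarrow> continuous_on UNIV f"
| "C_k (Suc k) f \<longleftrightarrow>
     (\<forall>x. f differentiable (at x)) \<and> (\<forall>b\<in>Basis. C_k k (partial_deriv b f))"

text \<open>Test functions on \<open>\<Omega>\<close> are represented by their extension by zero to the whole space.\<close>

definition test_functions :: "'a::euclidean_space set \<Rightarrow> ('a \<Rightarrow> real) set" where
  "test_functions \<Omega> =
     {\<phi>. (\<forall>k. C_k k \<phi>) \<and> compact (closure {x. \<phi> x \<noteq> 0}) \<and> closure {x. \<phi> x \<noteq> 0} \<subseteq> \<Omega>}"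

text \<open>
  Elements of \<open>L2 \<Omega>\<close> are pointwise defined functions, not classes modulo almost everywhere
  equality; their values outside \<open>\<Omega>\<close> are irrelevant. A change of representative is always
  made explicit below.
\<close>

definition L2 :: "'a::euclidean_space set \<Rightarrow> ('a \<Rightarrow> real) set" where
  "L2 \<Omega> = {u \<in> borel_measurable (lebesgue_on \<Omega>). integrable (lebesgue_on \<Omega>) (\<lambda>x. (u x)\<^sup>2)}"

definition weak_dir_deriv ::
  "'a::euclidean_space set \<Rightarrow> 'a \<Rightarrow> ('a \<Rightarrow> real) \<Rightarrow> ('a \<Rightarrow> real) \<Rightarrow> bool" where
  "weak_dir_deriv \<Omega> \<theta> u v \<longleftrightarrow>
     (\<forall>\<phi>\<in>test_functions \<Omega>.
        (\<integral>x. u x * (\<theta> \<bullet> gradient \<phi> x) \<partial>lebesgue_on \<Omega>) = - (\<integral>x. v x * \<phi> x \<partial>lebesgue_on \<Omega>))"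

definition W_dir :: "'a::euclidean_space \<Rightarrow> 'a set \<Rightarrow> ('a \<Rightarrow> real) set" where
  "W_dir \<theta> \<Omega> = {u \<in> L2 \<Omega>. \<exists>v\<in>L2 \<Omega>. weak_dir_deriv \<Omega> \<theta> u v}"

definition H1 :: "'a::euclidean_space set \<Rightarrow> ('a \<Rightarrow> real) set" where
  "H1 \<Omega> = {u \<in> L2 \<Omega>. \<forall>b\<in>Basis. \<exists>v\<in>L2 \<Omega>. weak_dir_deriv \<Omega> b u v}"

definition hyperplane :: "'a::euclidean_space \<Rightarrow> 'a set" where
  "hyperplane \<theta> = {y. y \<bullet> \<theta> = 0}"

definition hyp_proj :: "'a::euclidean_space \<Rightarrow> 'a \<Rightarrow> 'a" where
  "hyp_proj \<theta> x = x - (x \<bullet> \<theta>) *\<^sub>R \<theta>"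

definition orthonormal_basis_of :: "'a::euclidean_space set \<Rightarrow> 'a set \<Rightarrow> bool" where
  "orthonormal_basis_of S B \<longleftrightarrow> pairwise orthogonal B \<and> (\<forall>b\<in>B. norm b = 1) \<and> span B = S"

lemma orthonormal_basis_of_hyperplane_exists: "\<exists>B. orthonormal_basis_of (hyperplane \<theta>) B"
proof -
  have "subspace (hyperplane \<theta>)"
    by (auto simp: hyperplane_def subspace_def inner_left_distrib)
  then show ?thesis
    by (metis orthonormal_basis_of_def orthonormal_basis_subspace)
qed

text \<open>
  Lebesgue measure of dimension \<open>d - 1\<close> on the hyperplane: the image of the product Lebesgue
  measure under the isometry attached to an orthonormal basis \<open>B\<close> of the hyperplane, in the same
  way as \<^const>\<open>lborel\<close> is built from \<^const>\<open>Basis\<close>. The result does not depend on \<open>B\<close>.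
  For \<open>d = 1\<close> the basis is empty and the measure is the unit mass at \<open>0\<close>.
\<close>

definition hyperplane_lborel :: "'a::euclidean_space \<Rightarrow> 'a measure" where
  "hyperplane_lborel \<theta> =
     (let B = (SOME B. orthonormal_basis_of (hyperplane \<theta>) B) in
        distr (\<Pi>\<^sub>M b\<in>B. lborel) (restrict_space borel (hyperplane \<theta>)) (\<lambda>c. \<Sum>b\<in>B. c b *\<^sub>R b))"

definition hyperplane_lebesgue :: "'a::euclidean_space \<Rightarrow> 'a measure" where
  "hyperplane_lebesgue \<theta> = completion (hyperplane_lborel \<theta>)"

definition line_section :: "'a::euclidean_space \<Rightarrow> 'a set \<Rightarrow> 'a \<Rightarrow> real set" where
  "line_section \<theta> \<Omega> y = {s. s *\<^sub>R \<theta> + y \<in> \<Omega>}"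

text \<open>
  In the definition below \<open>u'\<close> is the chosen representative of \<open>u\<close>. The function \<open>w\<close> is the
  representative of \<open>s \<mapsto> u' (s \<theta> + y)\<close> that is continuous on \<open>]\<alpha>, \<beta>]\<close>; it is unique there.
  Only the values of \<open>g\<close> on the boundary of \<open>\<Omega>\<close> matter.
\<close>

definition directional_trace ::
  "'a::euclidean_space \<Rightarrow> 'a set \<Rightarrow> ('a \<Rightarrow> real) \<Rightarrow> ('a \<Rightarrow> real) \<Rightarrow> bool" where
  "directional_trace \<theta> \<Omega> u g \<longleftrightarrow>
     (\<exists>u'\<in>L2 \<Omega>. \<exists>A \<subseteq> hyp_proj \<theta> ` \<Omega>.
        (AE x in lebesgue_on \<Omega>. u' x = u x) \<and>
        hyp_proj \<theta> ` \<Omega> - A \<in> null_sets (hyperplane_lebesgue \<theta>) \<and>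
        (\<forall>y\<in>A.
           (\<lambda>s. u' (s *\<^sub>R \<theta> + y)) \<in> H1 (line_section \<theta> \<Omega> y) \<and>
           (\<forall>\<alpha> \<beta>. {\<alpha><..<\<beta>} \<in> components (line_section \<theta> \<Omega> y) \<longrightarrow>
              (\<exists>w. continuous_on {\<alpha><..\<beta>} w \<and>
                   (AE s in lebesgue_on {\<alpha><..<\<beta>}. w s = u' (s *\<^sub>R \<theta> + y)) \<and>
                   g (\<beta> *\<^sub>R \<theta> + y) = w \<beta>))))"

end

theory Submission
  imports Defs
begin

text \<open>
  Extend \<open>u\<close> and its weak derivative \<open>v\<close> in the direction \<open>\<theta>\<close> by zero to Borel functions on the
  whole space. The key identity is
  \<open>u (x + h \<theta>) - u x = h \<integral>\<^sub>0\<^sup>1 v (x + t h \<theta>) dt\<close>, valid for each \<open>h\<close> and almost every \<open>x\<close> such that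
  the segment from \<open>x\<close> to \<open>x + h \<theta>\<close> lies in \<open>\<Omega>\<close>. It results from testing the weak derivative with
  the average of a test function \<open>\<phi>\<close> along segments parallel to \<open>\<theta>\<close>: the directional derivative of
  the average is a finite difference of \<open>\<phi>\<close> (lemma \<open>directional_derivative_segment_average\<close>), Fubini
  moves the average from \<open>\<phi>\<close> to \<open>v\<close>, and the fundamental lemma of the calculus of variations
  removes \<open>\<phi>\<close> (lemma \<open>AE_difference_eq_integral_of_weak_derivative\<close>).

  Lebesgue measure is the product of the measure on the hyperplane orthogonal to \<open>\<theta>\<close> and of the
  measure on the line (theorem \<open>lborel_eq_hyperplane_times_line\<close>, which rests on the invariance of
  Lebesgue measure under orthogonal maps). Therefore, on almost every line parallel to \<open>\<theta>\<close>, the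
  identity holds for almost every base point and almost every increment. One good base point in
  each component shows that the slice of \<open>u\<close> is, almost everywhere in the section of \<open>\<Omega>\<close>, a
  primitive of the slice of \<open>v\<close> plus a constant for each component (lemma
  \<open>AE_eq_primitive_plus_locally_constant\<close>). Such a function has the slice of \<open>v\<close> as its weak
  derivative, so the slice of \<open>u\<close> belongs to \<open>H\<^sup>1\<close>. Since the primitive is continuous on the whole
  line, on each component \<open>]\<alpha>, \<beta>[\<close> it provides the representative that is continuous up to \<open>\<beta>\<close>.

  The value of this representative at \<open>\<beta>\<close> is a one-sided limit, which the averages
  \<open>\<integral>\<^sub>0\<^sup>1 u (x - (t / n) \<theta>) dt\<close> detect at the boundary point \<open>x = \<beta> \<theta> + y\<close> as \<open>n\<close> grows. Each average is a
  Borel function of \<open>x\<close> on the whole space, and \<open>g\<close> is defined as their limit. Thus \<open>g\<close> is Borel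
  measurable however irregular the boundary may be.
\<close>

section \<open>Smooth functions\<close>

lemma partial_deriv_eq:
  assumes "(f has_derivative f') (at x)"
  shows "partial_deriv b f x = f' b"
  using frechet_derivative_at[OF assms] by (simp add: partial_deriv_def)

lemma C_k_SucI:
  assumes "\<And>x. (f has_derivative f' x) (at x)" and "\<And>b. b \<in> Basis \<Longrightarrow> C_k k (\<lambda>x. f' x b)"
  shows "C_k (Suc k) f"
proof -
  have "partial_deriv b f = (\<lambda>x. f' x b)" for b
    using partial_deriv_eq[OF assms(1)] by auto
  then show ?thesis
    using assms by (auto simp: differentiable_def)
qed

lemma C_k_SucD:
  assumes "C_k (Suc k) f"
  shows "C_k k f"
  using assms
proof (induction k arbitrary: f)
  case 0
  then show ?case
    by (auto simp: differentiable_imp_continuous_within continuous_on_eq_continuous_within)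
next
  case (Suc k)
  then show ?case
    by (metis C_k.simps(2))
qed

lemma C_k_Suc_has_derivative:
  assumes "C_k (Suc k) f"
  shows "(f has_derivative (\<lambda>h. \<Sum>b\<in>Basis. (h \<bullet> b) * partial_deriv b f x)) (at x)"
proof -
  have d: "(f has_derivative frechet_derivative f (at x)) (at x)"
    using assms by (simp add: frechet_derivative_works)
  then interpret bounded_linear "frechet_derivative f (at x)"
    by (rule has_derivative_bounded_linear)
  have "frechet_derivative f (at x) h = (\<Sum>b\<in>Basis. (h \<bullet> b) * partial_deriv b f x)" for h
    unfolding partial_deriv_def
    by (subst euclidean_representation[of h, symmetric]) (simp add: sum scale)
  then have "frechet_derivative f (at x) = (\<lambda>h. \<Sum>b\<in>Basis. (h \<bullet> b) * partial_deriv b f x)"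
    by blast
  with d show ?thesis
    by simp
qed

lemma inner_gradient: "h \<bullet> gradient f x = (\<Sum>b\<in>Basis. (h \<bullet> b) * partial_deriv b f x)"
  by (simp add: gradient_def inner_sum_right mult.commute)

lemma C_k_Suc_has_derivative_gradient:
  assumes "C_k (Suc k) f"
  shows "(f has_derivative (\<lambda>h. h \<bullet> gradient f x)) (at x)"
  using C_k_Suc_has_derivative[OF assms] by (simp add: inner_gradient)

lemma continuous_on_C_k:
  assumes "C_k k f"
  shows "continuous_on UNIV f"
  using assms
  by (cases k) (auto simp: differentiable_imp_continuous_within continuous_on_eq_continuous_within)

lemma continuous_on_gradient:
  assumes "C_k (Suc k) f"
  shows "continuous_on UNIV (\<lambda>x. h \<bullet> gradient f x)"
proof -
  have "continuous_on UNIV (partial_deriv b f)" if "b \<in> Basis" for b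
    using assms that by (auto intro: continuous_on_C_k)
  then show ?thesis
    unfolding inner_gradient by (intro continuous_intros)
qed

lemma C_k_const: "C_k k (\<lambda>x. c)"
proof (induction k arbitrary: c)
  case (Suc k)
  show ?case
    by (rule C_k_SucI[where f' = "\<lambda>_ _. 0"]) (use Suc in auto)
qed auto

lemma C_k_add:
  assumes "C_k k f" "C_k k g"
  shows "C_k k (\<lambda>x. f x + g x)"
  using assms
proof (induction k arbitrary: f g)
  case (Suc k)
  show ?case
    by (rule C_k_SucI, rule has_derivative_add)
      (use Suc in \<open>auto intro!: Suc.IH simp: frechet_derivative_works partial_deriv_def[abs_def]\<close>)
qed (auto intro: continuous_intros)

lemma C_k_mult:
  assumes "C_k k f" "C_k k g"
  shows "C_k k (\<lambda>x. f x * g x)"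
  using assms
proof (induction k arbitrary: f g)
  case (Suc k)
  note C = C_k_SucD[OF Suc.prems(1)] C_k_SucD[OF Suc.prems(2)]
  show ?case
    by (rule C_k_SucI, rule has_derivative_mult)
      (use Suc C in \<open>auto intro!: C_k_add Suc.IH
        simp: frechet_derivative_works partial_deriv_def[abs_def]\<close>)
qed (auto intro: continuous_intros)

lemma C_k_prod:
  assumes "\<And>i. i \<in> I \<Longrightarrow> C_k k (f i)"
  shows "C_k k (\<lambda>x. \<Prod>i\<in>I. f i x)"
  using assms
  by (induction I rule: infinite_finite_induct) (auto intro: C_k_const C_k_mult)

text \<open>
  The induction on \<open>k\<close> runs over the whole sequence of derivatives at once, because one
  differentiation replaces \<open>g j\<close> by a multiple of \<open>g (Suc j)\<close>.
\<close>

lemma C_k_compose_inner: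
  fixes g :: "nat \<Rightarrow> real \<Rightarrow> real"
  assumes "\<And>j t. (g j has_real_derivative g (Suc j) t) (at t)"
  shows "C_k k (\<lambda>x. g j (x \<bullet> e + a))"
proof (induction k arbitrary: j)
  case 0
  have "continuous_on UNIV (g j)"
    using assms by (meson DERIV_isCont continuous_at_imp_continuous_on)
  then show ?case
    by (auto intro!: continuous_intros continuous_on_compose2[of UNIV "g j"])
next
  case (Suc k)
  show ?case
  proof (rule C_k_SucI)
    show "((\<lambda>x. g j (x \<bullet> e + a)) has_derivative (\<lambda>h. (h \<bullet> e) * g (Suc j) (x \<bullet> e + a))) (at x)" for x
      by (rule has_derivative_eq_rhs, rule DERIV_compose_FDERIV[where f = "g j", OF assms])
        (auto intro!: derivative_eq_intros)
    show "C_k k (\<lambda>x. (b \<bullet> e) * g (Suc j) (x \<bullet> e + a))" for b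
      by (intro C_k_mult C_k_const Suc)
  qed
qed

section \<open>Smooth approximations of the indicator function of a box\<close>

text \<open>
  The \<open>j\<close>-th derivative of the function that is \<open>exp (- 1 / t)\<close> for positive \<open>t\<close> and vanishes
  elsewhere is \<open>p\<^sub>j (1 / t) exp (- 1 / t)\<close> for positive \<open>t\<close>, with the polynomials \<open>p\<^sub>j\<close> obtained
  by differentiating this expression.
\<close>

primrec flat_poly :: "nat \<Rightarrow> real poly" where
  "flat_poly 0 = 1"
| "flat_poly (Suc j) = monom 1 2 * (flat_poly j - pderiv (flat_poly j))"

definition flat_exp :: "nat \<Rightarrow> real \<Rightarrow> real" where
  "flat_exp j t = (if t > 0 then poly (flat_poly j) (inverse t) * exp (- inverse t) else 0)"

lemma tendsto_poly_times_exp_minus: "((\<lambda>r. poly p r * exp (- r)) \<longlongrightarrow> 0) at_top" for p :: "real poly"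
proof -
  have "((\<lambda>r. \<Sum>i\<le>degree p. coeff p i * (r ^ i / exp r)) \<longlongrightarrow> (\<Sum>i\<le>degree p. coeff p i * 0)) at_top"
    by (intro tendsto_intros tendsto_power_div_exp_0)
  then show ?thesis
    by (simp add: poly_altdef exp_minus sum_distrib_right divide_inverse mult.assoc)
qed

text \<open>
  Only the point \<open>0\<close> needs an argument: on the right of it the difference quotient is again a
  polynomial in \<open>1 / h\<close> times \<open>exp (- 1 / h)\<close>, and the exponential wins.
\<close>

lemma DERIV_flat_exp: "(flat_exp j has_real_derivative flat_exp (Suc j) t) (at t)"
proof -
  consider "t > 0" | "t < 0" | "t = 0" by linarith
  then show ?thesis
  proof cases
    case 1
    have "((\<lambda>t. poly (flat_poly j) (inverse t) * exp (- inverse t)) has_real_derivative flat_exp (Suc j) t) (at t)"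
      using 1
      by (auto intro!: derivative_eq_intros DERIV_chain2[OF poly_DERIV]
          simp: flat_exp_def poly_monom algebra_simps power2_eq_square)
    then show ?thesis
      by (rule has_field_derivative_transform_within_open[where S = "{0<..}"])
        (use 1 in \<open>auto simp: flat_exp_def\<close>)
  next
    case 2
    have "((\<lambda>t. 0) has_real_derivative flat_exp (Suc j) t) (at t)"
      using 2 by (simp add: flat_exp_def)
    then show ?thesis
      by (rule has_field_derivative_transform_within_open[where S = "{..<0}"])
        (use 2 in \<open>auto simp: flat_exp_def\<close>)
  next
    case 3
    have "((\<lambda>h. poly (pCons 0 (flat_poly j)) (inverse h) * exp (- inverse h)) \<longlongrightarrow> 0) (at_right 0)"
      using tendsto_poly_times_exp_minus filterlim_inverse_at_top_right by (rule filterlim_compose)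
    then have "((\<lambda>h. flat_exp j h / h) \<longlongrightarrow> 0) (at_right 0)"
      by (rule Lim_transform_eventually)
        (auto simp: eventually_at_filter flat_exp_def field_simps)
    moreover have "((\<lambda>h. flat_exp j h / h) \<longlongrightarrow> 0) (at_left 0)"
      by (rule Lim_transform_eventually[OF tendsto_const])
        (auto simp: eventually_at_filter flat_exp_def)
    ultimately have "((\<lambda>h. flat_exp j h / h) \<longlongrightarrow> 0) (at 0)"
      by (simp add: filterlim_split_at)
    then have "(\<lambda>h. (flat_exp j (0 + h) - flat_exp j 0) / h) \<midarrow>0\<rightarrow> flat_exp (Suc j) 0"
      by (simp add: flat_exp_def[of _ 0])
    then show ?thesis
      using 3 by (simp add: DERIV_def)
  qed
qed

lemma flat_exp_0: "flat_exp 0 t = (if t > 0 then exp (- inverse t) else 0)"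
  by (simp add: flat_exp_def)

lemma flat_exp_0_bounds: "0 \<le> flat_exp 0 t" "flat_exp 0 t \<le> 1"
  by (auto simp: flat_exp_0)

lemma flat_exp_0_scaled_limit: "(\<lambda>n. flat_exp 0 (real n * t)) \<longlonglongrightarrow> (if t > 0 then 1 else 0)"
proof (cases "t > 0")
  case True
  then have "filterlim (\<lambda>n. real n * t) at_top sequentially"
    using filterlim_tendsto_pos_mult_at_top[OF tendsto_const _ filterlim_real_sequentially, of t]
    by (simp add: mult.commute)
  then have "(\<lambda>n. exp (- inverse (real n * t))) \<longlonglongrightarrow> exp (- 0)"
    by (intro tendsto_intros tendsto_inverse_0_at_top)
  moreover have "\<forall>\<^sub>F n in sequentially. exp (- inverse (real n * t)) = flat_exp 0 (real n * t)"
    using eventually_gt_at_top[of 0] by eventually_elim (use True in \<open>auto simp: flat_exp_0\<close>)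
  ultimately show ?thesis
    using True by (auto intro: Lim_transform_eventually)
next
  case False
  then have "flat_exp 0 (real n * t) = 0" for n
    by (auto simp: flat_exp_0 zero_less_mult_iff)
  then show ?thesis
    using False by simp
qed

text \<open>
  The factor \<open>n\<close> turns each \<open>exp (- 1 / t)\<close> into \<open>exp (- 1 / (n t))\<close>, which tends to \<open>1\<close> for
  positive \<open>t\<close>. So these smooth functions approximate the indicator function of the open box
  while they vanish outside it.
\<close>

definition box_bump :: "'a::euclidean_space \<Rightarrow> 'a \<Rightarrow> nat \<Rightarrow> 'a \<Rightarrow> real" where
  "box_bump a c n x =
     (\<Prod>b\<in>Basis. flat_exp 0 (real n * (x \<bullet> b - a \<bullet> b)) * flat_exp 0 (real n * (c \<bullet> b - x \<bullet> b)))"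

lemma C_k_box_bump: "C_k k (box_bump a c n)"
proof -
  have "C_k k (\<lambda>x. \<Prod>b\<in>Basis. flat_exp 0 (x \<bullet> (real n *\<^sub>R b) + - real n * (a \<bullet> b))
      * flat_exp 0 (x \<bullet> (- real n *\<^sub>R b) + real n * (c \<bullet> b)))"
    by (intro C_k_prod C_k_mult C_k_compose_inner DERIV_flat_exp)
  then show ?thesis
    by (simp add: box_bump_def[abs_def] algebra_simps)
qed

lemma box_bump_bounds: "0 \<le> box_bump a c n x" "box_bump a c n x \<le> 1"
  by (auto simp: box_bump_def intro!: prod_nonneg prod_le_1 mult_le_one mult_nonneg_nonneg flat_exp_0_bounds)

lemma box_bump_nonzeroD:
  assumes "box_bump a c n x \<noteq> 0"
  shows "x \<in> box a c"
  using assms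
  by (auto simp: box_bump_def mem_box flat_exp_0 zero_less_mult_iff split: if_splits)

lemma box_bump_limit: "(\<lambda>n. box_bump a c n x) \<longlonglongrightarrow> (indicator (box a c) x :: real)"
proof -
  have "(\<lambda>n. box_bump a c n x) \<longlonglongrightarrow>
     (\<Prod>b\<in>Basis. (if x \<bullet> b - a \<bullet> b > 0 then 1 else 0) * (if c \<bullet> b - x \<bullet> b > 0 then 1 else 0))"
    unfolding box_bump_def by (intro tendsto_intros flat_exp_0_scaled_limit)
  moreover have "(\<Prod>b\<in>Basis. (if x \<bullet> b - a \<bullet> b > 0 then 1 else 0) * (if c \<bullet> b - x \<bullet> b > 0 then 1 else 0))
      = (indicator (box a c) x :: real)"
  proof (cases "x \<in> box a c")
    case False
    then obtain b where "b \<in> Basis" "\<not> (a \<bullet> b < x \<bullet> b \<and> x \<bullet> b < c \<bullet> b)"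
      by (auto simp: mem_box)
    then show ?thesis
      using False by (intro prod_zero[THEN trans]) auto
  qed (auto simp: mem_box)
  ultimately show ?thesis
    by simp
qed

lemma box_bump_test_function:
  assumes "cbox a c \<subseteq> U"
  shows "box_bump a c n \<in> test_functions U"
proof -
  have sub: "closure {x. box_bump a c n x \<noteq> 0} \<subseteq> cbox a c"
    using box_bump_nonzeroD[of a c n] box_subset_cbox by (intro closure_minimal) auto
  then have "compact (closure {x. box_bump a c n x \<noteq> 0})"
    by (meson bounded_cbox bounded_subset closed_closure compact_eq_bounded_closed)
  with sub assms show ?thesis
    by (auto simp: test_functions_def C_k_box_bump)
qed

section \<open>The fundamental lemma of the calculus of variations\<close>

text \<open>
  The sets over which \<open>F\<close> has integral \<open>0\<close> are closed under disjoint countable unions, and under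
  complements because the total integral is \<open>0\<close>. Boxes are closed under intersection and
  generate the Borel sets, so \<open>F\<close> has integral \<open>0\<close> over every Borel set.
\<close>

lemma AE_eq_0_if_box_integrals_eq_0:
  fixes F :: "'a::euclidean_space \<Rightarrow> real"
  assumes F: "integrable lborel F"
    and total: "(\<integral>x. F x \<partial>lborel) = 0"
    and boxes: "\<And>a b. (\<integral>x. indicator (box a b) x * F x \<partial>lborel) = 0"
  shows "AE x in lborel. F x = 0"
proof -
  have int: "integrable lborel (\<lambda>x. indicator A x * F x)" if "A \<in> sets borel" for A
    using integrable_mult_indicator[OF _ F, of A] that by simp
  have "(\<integral>x. indicator A x * F x \<partial>lborel) = 0" if "A \<in> sets borel" for A
  proof -
    have A: "A \<in> sigma_sets UNIV (range (\<lambda>(a, b). box a b))"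
      using that unfolding borel_eq_box by simp
    have "Int_stable (range (\<lambda>(a, b). box a b))" "range (\<lambda>(a, b). box a b) \<subseteq> Pow UNIV"
      by (auto simp: Int_stable_def box_Int_box)
    from this A show ?thesis
    proof (induction rule: sigma_sets_induct_disjoint)
      case (compl A)
      then have A: "A \<in> sets borel"
        by (simp add: borel_eq_box)
      have "indicator (UNIV - A) x * F x = F x - indicator A x * F x" for x
        by (auto simp: indicator_def)
      then show ?case
        using int[OF A] F compl by (simp add: total)
    next
      case (union D)
      then have D: "D i \<in> sets borel" for i
        by (simp add: borel_eq_box subset_eq)
      have "(\<integral>x\<in>(\<Union>i. D i). F x \<partial>lborel) = (\<Sum>i. \<integral>x\<in>D i. F x \<partial>lborel)"
      proof (rule lebesgue_integral_countable_add)
        show "D i \<inter> D j = {}" if "i \<noteq> j" for i j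
          using union.hyps(1) that by (auto simp: disjoint_family_on_def)
      qed (use D int[of "\<Union>i. D i"] in \<open>auto simp: set_integrable_def\<close>)
      then show ?case
        using union.IH by (simp add: set_lebesgue_integral_def)
    qed (auto simp: boxes)
  qed
  then show ?thesis
    by (intro density_unique_real F) (auto simp: set_lebesgue_integral_def)
qed

lemma integral_over_box_eq_0:
  fixes F :: "'a::euclidean_space \<Rightarrow> real"
  assumes F: "integrable lborel F"
    and weak: "\<And>\<phi>. \<phi> \<in> test_functions U \<Longrightarrow> (\<integral>x. F x * \<phi> x \<partial>lborel) = 0"
    and "cbox a c \<subseteq> U"
  shows "(\<integral>x. indicator (box a c) x * F x \<partial>lborel) = 0"
proof -
  have "(\<lambda>n. \<integral>x. F x * box_bump a c n x \<partial>lborel) \<longlonglongrightarrow> (\<integral>x. F x * indicator (box a c) x \<partial>lborel)"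
  proof (rule integral_dominated_convergence[where w = "\<lambda>x. \<bar>F x\<bar>"])
    show "(\<lambda>x. F x * box_bump a c n x) \<in> borel_measurable lborel" for n
      using borel_measurable_integrable[OF F]
        borel_measurable_continuous_onI[OF continuous_on_C_k[OF C_k_box_bump[of 0 a c n]]]
      by simp
    show "AE x in lborel. norm (F x * box_bump a c n x) \<le> \<bar>F x\<bar>" for n
      using box_bump_bounds[of a c n] by (auto simp: abs_mult intro!: mult_left_le)
  qed (use F in \<open>auto intro!: tendsto_intros box_bump_limit\<close>)
  moreover have "(\<integral>x. F x * box_bump a c n x \<partial>lborel) = 0" for n
    by (intro weak box_bump_test_function assms)
  ultimately show ?thesis
    by (simp add: LIMSEQ_const_iff mult.commute)
qed

text \<open>
  On a closed box inside \<open>U\<close>, the function \<open>F\<close> cut off to that box has integral \<open>0\<close> over every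
  box, since the intersection of two boxes is a box whose closure stays inside \<open>U\<close>. Countably
  many closed boxes cover \<open>U\<close>.
\<close>

lemma AE_eq_0_if_test_integrals_eq_0:
  fixes F :: "'a::euclidean_space \<Rightarrow> real"
  assumes F: "integrable lborel F"
    and weak: "\<And>\<phi>. \<phi> \<in> test_functions U \<Longrightarrow> (\<integral>x. F x * \<phi> x \<partial>lborel) = 0"
    and "open U"
  shows "AE x in lborel. x \<in> U \<longrightarrow> F x = 0"
proof -
  have cube: "AE x in lborel. x \<in> cbox p q \<longrightarrow> F x = 0" if "cbox p q \<subseteq> U" for p q
  proof -
    have boxes: "(\<integral>x. indicator (box a b) x * (indicator (box p q) x * F x) \<partial>lborel) = 0" for a b
    proof -
      define a' b' where "a' = (\<Sum>i\<in>Basis. max (a \<bullet> i) (p \<bullet> i) *\<^sub>R i)"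
        and "b' = (\<Sum>i\<in>Basis. min (b \<bullet> i) (q \<bullet> i) *\<^sub>R i)"
      have "box a b \<inter> box p q = box a' b'"
        by (simp add: box_Int_box a'_def b'_def)
      then have eq: "indicator (box a b) x * (indicator (box p q) x * F x) = indicator (box a' b') x * F x" for x
        by (metis indicator_inter_arith mult.assoc)
      have "cbox a' b' \<subseteq> U"
        using that by (force simp: a'_def b'_def mem_box)
      from integral_over_box_eq_0[OF F weak this] show ?thesis
        unfolding eq .
    qed
    have "integrable lborel (\<lambda>x. indicator (box p q) x * F x)"
      using integrable_mult_indicator[OF _ F, of "box p q"] by simp
    then have "AE x in lborel. indicator (box p q) x * F x = 0"
      by (rule AE_eq_0_if_box_integrals_eq_0)
        (use boxes integral_over_box_eq_0[OF F weak that] in auto)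
    moreover have "AE x in lborel. x \<notin> cbox p q - box p q"
      using negligible_frontier_interval[of p q]
      by (intro AE_not_in) (simp add: negligible_iff_null_sets null_sets_completion_iff)
    ultimately show ?thesis
      by eventually_elim (auto simp: indicator_def split: if_splits)
  qed
  obtain \<D> where \<D>: "countable \<D>" "\<D> \<subseteq> Pow U" "\<And>X. X \<in> \<D> \<Longrightarrow> \<exists>a b. X = cbox a b" "\<Union>\<D> = U"
  proof (rule open_countable_Union_open_cbox[OF \<open>open U\<close>])
    fix \<D> assume "countable \<D>" "\<D> \<subseteq> Pow U" "\<And>X. X \<in> \<D> \<Longrightarrow> \<exists>a b. X = cbox a b" "\<Union>\<D> = U"
    then show thesis by (rule that)
  qed
  have "AE x in lborel. x \<in> X \<longrightarrow> F x = 0" if "X \<in> \<D>" for X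
    using cube \<D>(2) \<D>(3)[OF that] that by auto
  then have "AE x in lborel. \<forall>X\<in>\<D>. x \<in> X \<longrightarrow> F x = 0"
    by (subst AE_ball_countable[OF \<D>(1)]) auto
  then show ?thesis
    by eventually_elim (use \<D>(4) in blast)
qed

section \<open>Averaging a test function along a segment\<close>

text \<open>
  Inserting this average into the weak formulation turns the derivative of a test function in
  the direction \<open>k\<close> into a finite difference.
\<close>

definition segment_average :: "'a::euclidean_space \<Rightarrow> ('a \<Rightarrow> real) \<Rightarrow> 'a \<Rightarrow> real" where
  "segment_average k \<phi> x = integral {0..1} (\<lambda>t. \<phi> (x - t *\<^sub>R k))"

text \<open>
  Differentiation under the integral sign: the partial derivatives of the average are the
  averages of the partial derivatives, which is what makes the average smooth.
\<close>

lemma segment_average_has_derivative: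
  assumes "C_k (Suc m) \<phi>"
  shows "(segment_average k \<phi> has_derivative
    (\<lambda>h. \<Sum>b\<in>Basis. (h \<bullet> b) * segment_average k (partial_deriv b \<phi>) x)) (at x)"
proof -
  define D where "D x t = (\<Sum>b\<in>Basis. partial_deriv b \<phi> (x - t *\<^sub>R k) *\<^sub>R blinfun_inner_left b)" for x and t :: real
  have D: "blinfun_apply (D x t) = (\<lambda>h. (\<Sum>b\<in>Basis. (h \<bullet> b) * partial_deriv b \<phi> (x - t *\<^sub>R k)))" for x t
    by (rule ext) (simp add: D_def blinfun.bilinear_simps inner_commute mult.commute)
  have pcont: "continuous_on UNIV (partial_deriv b \<phi>)" if "b \<in> Basis" for b
    using assms that by (auto intro: continuous_on_C_k)
  have cont: "continuous_on UNIV \<phi>"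
    using assms by (rule continuous_on_C_k)
  have int: "(\<lambda>t. f (x - t *\<^sub>R k)) integrable_on {0..1::real}" if "continuous_on UNIV f" for f :: "'a \<Rightarrow> real" and x
    by (intro integrable_continuous_interval continuous_intros continuous_on_compose2[OF that]) auto
  have Dcont: "continuous_on (UNIV \<times> cbox 0 1) (\<lambda>(x, t). D x t)"
    unfolding D_def split_beta
    by (intro continuous_intros continuous_on_compose2[OF pcont]) auto
  have deriv: "((\<lambda>x. integral (cbox 0 1) (\<lambda>t. \<phi> (x - t *\<^sub>R k))) has_derivative integral (cbox 0 1) (D x)) (at x within UNIV)"
  proof (rule leibniz_rule[OF _ _ Dcont])
    fix x t
    have "((\<lambda>x. \<phi> (x - t *\<^sub>R k)) has_derivative (\<lambda>h. \<Sum>b\<in>Basis. (h \<bullet> b) * partial_deriv b \<phi> (x - t *\<^sub>R k))) (at x)"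
      by (rule has_derivative_eq_rhs, rule has_derivative_compose[OF _ C_k_Suc_has_derivative[OF assms]])
        (auto intro!: derivative_eq_intros)
    then show "((\<lambda>x. \<phi> (x - t *\<^sub>R k)) has_derivative blinfun_apply (D x t)) (at x within UNIV)"
      by (simp add: D)
  qed (use int[OF cont] in auto)
  have "blinfun_apply (integral (cbox 0 1) (D x)) h
      = (\<Sum>b\<in>Basis. (h \<bullet> b) * segment_average k (partial_deriv b \<phi>) x)" for h
  proof -
    have "D x integrable_on cbox 0 1"
      by (intro integrable_continuous continuous_on_compose2[OF Dcont, of _ "\<lambda>t. (x, t)", simplified])
        (auto intro!: continuous_intros)
    then have "blinfun_apply (integral (cbox 0 1) (D x)) h = integral {0..1} (\<lambda>t. blinfun_apply (D x t) h)"
      by (simp add: blinfun_apply_integral)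
    also have "\<dots> = (\<Sum>b\<in>Basis. integral {0..1} (\<lambda>t. (h \<bullet> b) * partial_deriv b \<phi> (x - t *\<^sub>R k)))"
      unfolding D by (intro integral_sum integrable_on_mult_right int pcont) auto
    finally show ?thesis
      by (simp add: segment_average_def)
  qed
  then have "blinfun_apply (integral (cbox 0 1) (D x))
      = (\<lambda>h. \<Sum>b\<in>Basis. (h \<bullet> b) * segment_average k (partial_deriv b \<phi>) x)"
    by (rule ext)
  with deriv show ?thesis
    by (simp add: segment_average_def[abs_def])
qed

lemma C_k_segment_average:
  assumes "C_k m \<phi>"
  shows "C_k m (segment_average k \<phi>)"
  using assms
proof (induction m arbitrary: \<phi>)
  case 0
  have "continuous_on (UNIV \<times> cbox 0 1) (\<lambda>(x, t). \<phi> (x - t *\<^sub>R k))"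
    unfolding split_beta using 0
    by (auto intro!: continuous_intros continuous_on_compose2[of UNIV \<phi>])
  from integral_continuous_on_param[OF this] show ?case
    by (simp add: segment_average_def[abs_def])
next
  case (Suc m)
  show ?case
  proof (rule C_k_SucI[OF segment_average_has_derivative[OF Suc.prems]])
    fix b :: 'a assume "b \<in> Basis"
    then have "(\<Sum>b'\<in>Basis. (b \<bullet> b') * segment_average k (partial_deriv b' \<phi>) x)
        = segment_average k (partial_deriv b \<phi>) x" for x
      by (simp add: inner_Basis if_distrib[of "\<lambda>c. c * _"] cong: if_cong)
    with \<open>b \<in> Basis\<close> Suc show "C_k m (\<lambda>x. \<Sum>b'\<in>Basis. (b \<bullet> b') * segment_average k (partial_deriv b' \<phi>) x)"
      by simp
  qed
qed

text \<open>
  The directional derivative of the average is the integral, over the segment, of the derivative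
  of \<open>\<phi>\<close> along that segment.
\<close>

lemma directional_derivative_segment_average:
  assumes \<phi>: "C_k 1 \<phi>"
  shows "k \<bullet> gradient (segment_average k \<phi>) x = \<phi> x - \<phi> (x - k)"
proof -
  have C: "C_k (Suc 0) \<phi>" "C_k (Suc 0) (segment_average k \<phi>)"
    using \<phi> C_k_segment_average[OF \<phi>] by simp_all
  have pcont: "continuous_on UNIV (partial_deriv b \<phi>)" if "b \<in> Basis" for b
    using C(1) that by auto
  have "k \<bullet> gradient (segment_average k \<phi>) x
      = (\<Sum>b\<in>Basis. (k \<bullet> b) * segment_average k (partial_deriv b \<phi>) x)"
    using has_derivative_unique[OF C_k_Suc_has_derivative_gradient[OF C(2)] segment_average_has_derivative[OF C(1)]]
    by meson
  also have "\<dots> = integral {0..1} (\<lambda>t. k \<bullet> gradient \<phi> (x - t *\<^sub>R k))"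
    unfolding inner_gradient segment_average_def
    by (subst integral_sum)
      (auto intro!: integrable_continuous_interval continuous_intros continuous_on_compose2[OF pcont])
  also have "((\<lambda>t. k \<bullet> gradient \<phi> (x - t *\<^sub>R k)) has_integral (- \<phi> (x - 1 *\<^sub>R k)) - (- \<phi> (x - 0 *\<^sub>R k))) {0..1}"
  proof (rule fundamental_theorem_of_calculus)
    fix t :: real
    have "((\<lambda>t. \<phi> (x - t *\<^sub>R k)) has_derivative (\<lambda>r. (- r *\<^sub>R k) \<bullet> gradient \<phi> (x - t *\<^sub>R k))) (at t within {0..1})"
      by (rule has_derivative_compose[OF _ C_k_Suc_has_derivative_gradient[OF C(1)]])
        (auto intro!: derivative_eq_intros)
    then have "((\<lambda>t. - \<phi> (x - t *\<^sub>R k)) has_derivative (\<lambda>r. r *\<^sub>R (k \<bullet> gradient \<phi> (x - t *\<^sub>R k)))) (at t within {0..1})"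
      by (rule has_derivative_minus[THEN has_derivative_eq_rhs]) auto
    then show "((\<lambda>t. - \<phi> (x - t *\<^sub>R k)) has_vector_derivative k \<bullet> gradient \<phi> (x - t *\<^sub>R k)) (at t within {0..1})"
      by (simp add: has_vector_derivative_def)
  qed auto
  then have "integral {0..1} (\<lambda>t. k \<bullet> gradient \<phi> (x - t *\<^sub>R k)) = \<phi> x - \<phi> (x - k)"
    by (simp add: integral_unique)
  finally show ?thesis .
qed

text \<open>
  The support of the average is swept out by translating the support of \<open>\<phi>\<close> by \<open>t k\<close> for \<open>t\<close> in the
  unit interval; this is a continuous image of a compact set.
\<close>

lemma segment_average_test_function:
  assumes \<phi>: "\<phi> \<in> test_functions {x. \<forall>t\<in>{0..1}. x + t *\<^sub>R k \<in> \<Omega>}"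
  shows "segment_average k \<phi> \<in> test_functions \<Omega>"
proof -
  define K where "K = closure {x. \<phi> x \<noteq> 0}"
  define K' where "K' = (\<lambda>(x, t). x + t *\<^sub>R k) ` (K \<times> {0..1})"
  have K: "compact K" "K \<subseteq> {x. \<forall>t\<in>{0..1}. x + t *\<^sub>R k \<in> \<Omega>}"
    using \<phi> by (auto simp: test_functions_def K_def)
  have K': "compact K'"
    unfolding K'_def split_beta using K(1)
    by (intro compact_continuous_image continuous_intros compact_Times) auto
  have "segment_average k \<phi> x = 0" if x: "x \<notin> K'" for x
  proof -
    have "\<phi> (x - t *\<^sub>R k) = 0" if t: "t \<in> {0..1}" for t
    proof (rule ccontr)
      assume "\<phi> (x - t *\<^sub>R k) \<noteq> 0"
      then have "x - t *\<^sub>R k \<in> K"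
        using closure_subset[of "{x. \<phi> x \<noteq> 0}"] by (auto simp: K_def)
      then have "x \<in> K'"
        unfolding K'_def using t by (intro image_eqI[where x = "(x - t *\<^sub>R k, t)"]) auto
      with x show False ..
    qed
    then have "integral {0..1} (\<lambda>t. \<phi> (x - t *\<^sub>R k)) = integral {0..1} (\<lambda>t::real. 0)"
      by (intro integral_cong) auto
    then show ?thesis
      by (simp add: segment_average_def)
  qed
  then have sub: "closure {x. segment_average k \<phi> x \<noteq> 0} \<subseteq> K'"
    using K' by (intro closure_minimal compact_imp_closed) auto
  moreover have "K' \<subseteq> \<Omega>"
    using K(2) by (auto simp: K'_def)
  moreover have "compact (closure {x. segment_average k \<phi> x \<noteq> 0})"
    using sub K' by (meson bounded_subset closed_closure compact_eq_bounded_closed)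
  ultimately show ?thesis
    using \<phi> by (auto simp: test_functions_def C_k_segment_average)
qed

section \<open>Difference quotients of a function with a weak directional derivative\<close>

lemma integral_translate:
  fixes f :: "'a::euclidean_space \<Rightarrow> real"
  assumes "f \<in> borel_measurable borel"
  shows "(\<integral>x. f (x + c) \<partial>lborel) = (\<integral>x. f x \<partial>lborel)"
proof -
  have "(\<integral>x. f x \<partial>lborel) = (\<integral>x. f x \<partial>distr lborel borel ((+) c))"
    by (simp add: lborel_distr_plus)
  also have "\<dots> = (\<integral>x. f (x + c) \<partial>lborel)"
    using assms by (subst integral_distr) (auto simp: add.commute)
  finally show ?thesis by simp
qed

lemma integrable_translate:
  fixes f :: "'a::euclidean_space \<Rightarrow> real"
  assumes "integrable lborel f"
  shows "integrable lborel (\<lambda>x. f (x + c))"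
proof -
  have "integrable (distr lborel borel ((+) c)) f"
    by (simp add: lborel_distr_plus assms)
  then show ?thesis
    using borel_measurable_integrable[OF assms] by (subst (asm) integrable_distr_eq) (auto simp: add.commute)
qed

lemma integrable_translates_along_segment:
  fixes w :: "'a::euclidean_space \<Rightarrow> real"
  assumes w: "integrable lborel w"
  shows "integrable (lborel \<Otimes>\<^sub>M lborel) (\<lambda>(t::real, x). indicator {0..1} t * w (x + t *\<^sub>R k))"
proof -
  have [measurable]: "w \<in> borel_measurable borel"
    using w by auto
  have "integrable lborel (\<lambda>t::real. indicator {0..1} t * (\<integral>x. \<bar>w x\<bar> \<partial>lborel))"
    by (intro integrable_mult_left) auto
  then have "integrable lborel (\<lambda>t::real. \<integral>x. norm (indicator {0..1} t * w (x + t *\<^sub>R k)) \<partial>lborel)"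
    using integral_translate[of "\<lambda>x. \<bar>w x\<bar>"] by (simp add: abs_mult)
  then show ?thesis
    by (intro lborel_pair.Fubini_integrable) (use w in \<open>auto intro!: integrable_translate\<close>)
qed

lemma test_function_bounded:
  assumes "\<phi> \<in> test_functions U"
  obtains C where "\<And>x. \<bar>\<phi> x\<bar> \<le> C"
proof -
  define K where "K = closure {x. \<phi> x \<noteq> 0}"
  have "C_k 0 \<phi>"
    using assms unfolding test_functions_def by blast
  then have "continuous_on K \<phi>" "compact K"
    using assms unfolding test_functions_def K_def by (auto intro: continuous_on_subset)
  then have "bounded (\<phi> ` K)"
    by (meson compact_continuous_image compact_imp_bounded)
  then obtain C where C: "\<And>x. x \<in> K \<Longrightarrow> \<bar>\<phi> x\<bar> \<le> C"
    by (auto simp: bounded_iff)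
  have "\<bar>\<phi> x\<bar> \<le> max C 0" for x
  proof (cases "x \<in> K")
    case False
    then have "\<phi> x = 0"
      using closure_subset[of "{x. \<phi> x \<noteq> 0}"] by (auto simp: K_def)
    then show ?thesis by simp
  qed (use C in \<open>auto simp: le_max_iff_disj\<close>)
  with that show ?thesis .
qed

text \<open>
  Averaging backwards on \<open>\<phi>\<close> is dual to averaging forwards on \<open>v\<close>, by Fubini and translation
  invariance.
\<close>

lemma integral_times_segment_average:
  fixes v \<phi> :: "'a::euclidean_space \<Rightarrow> real"
  assumes v: "integrable lborel v"
    and cont: "continuous_on UNIV \<phi>" and bound: "\<And>x. \<bar>\<phi> x\<bar> \<le> C"
  shows "(\<integral>x. v x * segment_average k \<phi> x \<partial>lborel)
       = (\<integral>x. (\<integral>t. indicator {0..1} t * v (x + t *\<^sub>R k) \<partial>lborel) * \<phi> x \<partial>lborel)"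
proof -
  have [measurable]: "v \<in> borel_measurable borel" "\<phi> \<in> borel_measurable borel"
    using v cont by (auto intro: borel_measurable_continuous_onI)
  have bound': "norm (a * \<phi> x) \<le> norm (C * a)" for a x
    using mult_left_mono[OF bound, of "\<bar>a\<bar>" x] bound[of x] by (simp add: abs_mult mult.commute)
  have int1: "integrable (lborel \<Otimes>\<^sub>M lborel) (\<lambda>(t::real, x). indicator {0..1} t * v x * \<phi> (x - t *\<^sub>R k))"
    by (rule Bochner_Integration.integrable_bound[OF integrable_mult_right[of C, OF integrable_translates_along_segment[OF v, of 0]]])
      (use bound' in \<open>auto simp: split_beta\<close>)
  have int2: "integrable (lborel \<Otimes>\<^sub>M lborel) (\<lambda>(t::real, x). indicator {0..1} t * v (x + t *\<^sub>R k) * \<phi> x)"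
    by (rule Bochner_Integration.integrable_bound[OF integrable_mult_right[of C, OF integrable_translates_along_segment[OF v, of k]]])
      (use bound' in \<open>auto simp: split_beta\<close>)
  have avg: "segment_average k \<phi> x = (\<integral>t. indicator {0..1} t * \<phi> (x - t *\<^sub>R k) \<partial>lborel)" for x
  proof -
    have "set_integrable lborel {0..1} (\<lambda>t::real. \<phi> (x - t *\<^sub>R k))"
      by (intro borel_integrable_atLeastAtMost' continuous_intros continuous_on_compose2[OF cont]) auto
    from set_borel_integral_eq_integral(2)[OF this] show ?thesis
      by (simp add: segment_average_def set_lebesgue_integral_def)
  qed
  have "(\<integral>x. v x * segment_average k \<phi> x \<partial>lborel)
      = (\<integral>x. (\<integral>t. indicator {0..1} t * v x * \<phi> (x - t *\<^sub>R k) \<partial>lborel) \<partial>lborel)"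
    by (simp add: avg mult.assoc mult.left_commute flip: integral_mult_right_zero)
  also have "\<dots> = (\<integral>t. (\<integral>x. indicator {0..1} t * v x * \<phi> (x - t *\<^sub>R k) \<partial>lborel) \<partial>lborel)"
    by (rule lborel_pair.Fubini_integral[OF int1])
  also have "\<dots> = (\<integral>t. (\<integral>x. indicator {0..1} t * v (x + t *\<^sub>R k) * \<phi> x \<partial>lborel) \<partial>lborel)"
  proof (rule Bochner_Integration.integral_cong[OF refl])
    fix t :: real
    show "(\<integral>x. indicator {0..1} t * v x * \<phi> (x - t *\<^sub>R k) \<partial>lborel)
        = (\<integral>x. indicator {0..1} t * v (x + t *\<^sub>R k) * \<phi> x \<partial>lborel)"
      using integral_translate[of "\<lambda>x. indicator {0..1} t * v x * \<phi> (x - t *\<^sub>R k)" "t *\<^sub>R k"] by simp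
  qed
  also have "\<dots> = (\<integral>x. (\<integral>t. indicator {0..1} t * v (x + t *\<^sub>R k) * \<phi> x \<partial>lborel) \<partial>lborel)"
    by (rule lborel_pair.Fubini_integral[OF int2, symmetric])
  finally show ?thesis
    by simp
qed

lemma open_segment_translates:
  fixes \<Omega> :: "'a::euclidean_space set"
  assumes "open \<Omega>"
  shows "open {(x, h). \<forall>t\<in>{0..1}. x + (t * h) *\<^sub>R \<theta> \<in> \<Omega>}" (is "open ?U")
    and "open {x. \<forall>t\<in>{0..1}. x + t *\<^sub>R k \<in> \<Omega>}" (is "open ?V")
proof -
  have eq: "- ?U = {y. \<exists>t. t \<in> {0..1} \<and> (t, y) \<in> (\<lambda>(t, x, h). x + (t * h) *\<^sub>R \<theta>) -` (- \<Omega>)}"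
    by auto
  have "closed (- ?U)"
    unfolding eq split_beta using assms
    by (intro closed_compact_projection closed_vimage continuous_intros) auto
  then show "open ?U"
    by (simp add: open_closed)
  have eq: "- ?V = {y. \<exists>t. t \<in> {0..1} \<and> (t, y) \<in> (\<lambda>(t, x). x + t *\<^sub>R k) -` (- \<Omega>)}"
    by auto
  have "closed (- ?V)"
    unfolding eq split_beta using assms
    by (intro closed_compact_projection closed_vimage continuous_intros) auto
  then show "open ?V"
    by (simp add: open_closed)
qed

text \<open>
  For \<open>k = h \<theta>\<close> the average of \<open>\<phi>\<close> along \<open>k\<close> is a test function on \<open>\<Omega>\<close> as soon as \<open>\<phi>\<close> is one on the
  set of points whose segment to their translate by \<open>k\<close> lies in \<open>\<Omega>\<close>. Testing with it gives
  \<open>\<integral> u (\<phi> - \<phi> (\<cdot> - k)) = - h \<integral> v (segment_average k \<phi>)\<close>. Moving both translations off \<open>\<phi>\<close> leaves an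
  integrand multiplied by an arbitrary \<open>\<phi>\<close>, and the fundamental lemma applies to it.
\<close>

lemma AE_difference_eq_integral_of_weak_derivative:
  fixes u v :: "'a::euclidean_space \<Rightarrow> real"
  assumes u: "integrable lborel u" and v: "integrable lborel v" and "open \<Omega>"
    and weak: "\<And>\<phi>. \<phi> \<in> test_functions \<Omega> \<Longrightarrow>
      (\<integral>x. u x * (\<theta> \<bullet> gradient \<phi> x) \<partial>lborel) = - (\<integral>x. v x * \<phi> x \<partial>lborel)"
  shows "AE x in lborel. (\<forall>t\<in>{0..1}. x + (t * h) *\<^sub>R \<theta> \<in> \<Omega>) \<longrightarrow>
     u (x + h *\<^sub>R \<theta>) - u x = h * (\<integral>t. indicator {0..1} t * v (x + (t * h) *\<^sub>R \<theta>) \<partial>lborel)"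
proof -
  define k where "k = h *\<^sub>R \<theta>"
  define I where "I x = (\<integral>t. indicator {0..1} t * v (x + t *\<^sub>R k) \<partial>lborel)" for x
  define F where "F x = u (x + k) - u x - h * I x" for x
  define U where "U = {x. \<forall>t\<in>{0..1}. x + t *\<^sub>R k \<in> \<Omega>}"
  have I: "integrable lborel I"
    unfolding I_def by (intro lborel_pair.integrable_snd integrable_translates_along_segment v)
  then have F: "integrable lborel F"
    using u unfolding F_def by (intro Bochner_Integration.integrable_diff integrable_mult_right integrable_translate)
  have "(\<integral>x. F x * \<phi> x \<partial>lborel) = 0" if \<phi>: "\<phi> \<in> test_functions U" for \<phi>
  proof -
    obtain C where C: "\<And>x. \<bar>\<phi> x\<bar> \<le> C"
      using test_function_bounded[OF \<phi>] by blast
    have C1: "C_k 1 \<phi>"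
      using \<phi> unfolding test_functions_def by blast
    then have cont: "continuous_on UNIV \<phi>"
      by (rule continuous_on_C_k)
    then have [measurable]: "\<phi> \<in> borel_measurable borel"
      by (rule borel_measurable_continuous_onI)
    have [measurable]: "u \<in> borel_measurable borel"
      using u by auto
    have int: "integrable lborel (\<lambda>x. w x * \<phi> (x + c))" if w: "integrable lborel w" for w c
    proof (rule Bochner_Integration.integrable_bound[OF integrable_mult_right[of C, OF w]])
      show "AE x in lborel. norm (w x * \<phi> (x + c)) \<le> norm (C * w x)"
      proof (rule AE_I2)
        fix x
        have "\<bar>w x\<bar> * \<bar>\<phi> (x + c)\<bar> \<le> \<bar>w x\<bar> * C" "0 \<le> C"
          using C order_trans[OF abs_ge_zero C] by (auto intro!: mult_left_mono)
        then show "norm (w x * \<phi> (x + c)) \<le> norm (C * w x)"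
          by (simp add: abs_mult mult.commute)
      qed
    qed (use w in auto)
    have "(\<integral>x. u x * (\<phi> x - \<phi> (x - k)) \<partial>lborel)
        = h * (\<integral>x. u x * (\<theta> \<bullet> gradient (segment_average k \<phi>) x) \<partial>lborel)"
      unfolding directional_derivative_segment_average[OF C1, symmetric]
      by (simp add: k_def mult.left_commute)
    also have "\<dots> = - h * (\<integral>x. v x * segment_average k \<phi> x \<partial>lborel)"
      using weak[OF segment_average_test_function[OF \<phi>[unfolded U_def]]] by simp
    also have "\<dots> = - h * (\<integral>x. I x * \<phi> x \<partial>lborel)"
      unfolding I_def by (simp add: integral_times_segment_average[OF v cont C])
    also have "(\<integral>x. u x * (\<phi> x - \<phi> (x - k)) \<partial>lborel)
       = (\<integral>x. u x * \<phi> x \<partial>lborel) - (\<integral>x. u x * \<phi> (x - k) \<partial>lborel)"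
      using int[OF u, of 0] int[OF u, of "- k"] by (simp add: right_diff_distrib)
    also have "(\<integral>x. u x * \<phi> (x - k) \<partial>lborel) = (\<integral>x. u (x + k) * \<phi> x \<partial>lborel)"
      using integral_translate[of "\<lambda>x. u x * \<phi> (x - k)" k] by simp
    finally have "(\<integral>x. u (x + k) * \<phi> x \<partial>lborel) - (\<integral>x. u x * \<phi> x \<partial>lborel)
        - h * (\<integral>x. I x * \<phi> x \<partial>lborel) = 0"
      by simp
    moreover have "F x * \<phi> x = u (x + k) * \<phi> x - u x * \<phi> x - h * (I x * \<phi> x)" for x
      by (simp add: F_def algebra_simps)
    ultimately show ?thesis
      using int[OF u, of 0] int[OF I, of 0] int[OF integrable_translate[OF u, of k], of 0] by simp
  qed
  then have "AE x in lborel. x \<in> U \<longrightarrow> F x = 0"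
    using F open_segment_translates(2)[OF \<open>open \<Omega>\<close>]
    by (intro AE_eq_0_if_test_integrals_eq_0) (auto simp: U_def)
  then show ?thesis
    by eventually_elim (auto simp: U_def F_def I_def k_def)
qed

text \<open>
  The exchanged order of the quantifiers lets the identity be restricted to lines: for a
  typical line, a typical point of it serves as a base point for almost all increments \<open>h\<close>.
\<close>

lemma AE_AE_difference_eq_integral_of_weak_derivative:
  fixes u v :: "'a::euclidean_space \<Rightarrow> real"
  assumes u: "integrable lborel u" and v: "integrable lborel v" and "open \<Omega>"
    and weak: "\<And>\<phi>. \<phi> \<in> test_functions \<Omega> \<Longrightarrow>
      (\<integral>x. u x * (\<theta> \<bullet> gradient \<phi> x) \<partial>lborel) = - (\<integral>x. v x * \<phi> x \<partial>lborel)"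
  shows "AE x in lborel. AE h in lborel. (\<forall>t\<in>{0..1}. x + (t * h) *\<^sub>R \<theta> \<in> \<Omega>) \<longrightarrow>
     u (x + h *\<^sub>R \<theta>) - u x = h * (\<integral>t. indicator {0..1} t * v (x + (t * h) *\<^sub>R \<theta>) \<partial>lborel)"
proof -
  have [measurable]: "u \<in> borel_measurable borel" "v \<in> borel_measurable borel"
    using u v by auto
  have "{(x, h). \<forall>t\<in>{0..1}. x + (t * h) *\<^sub>R \<theta> \<in> \<Omega>} \<in> sets (lborel \<Otimes>\<^sub>M lborel)"
    using open_segment_translates(1)[OF \<open>open \<Omega>\<close>, of \<theta>]
    unfolding sets_pair_measure_cong[OF sets_lborel sets_lborel] borel_prod by (rule borel_open)
  then have [measurable]: "Measurable.pred (lborel \<Otimes>\<^sub>M lborel) (\<lambda>z. \<forall>t\<in>{0..1}. fst z + (t * snd z) *\<^sub>R \<theta> \<in> \<Omega>)"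
    by (simp add: pred_def space_pair_measure split_beta')
  have "{z \<in> space (lborel \<Otimes>\<^sub>M lborel). (\<forall>t\<in>{0..1}. fst z + (t * snd z) *\<^sub>R \<theta> \<in> \<Omega>) \<longrightarrow>
     u (fst z + snd z *\<^sub>R \<theta>) - u (fst z) =
       snd z * (\<integral>t. indicator {0..1} t * v (fst z + (t * snd z) *\<^sub>R \<theta>) \<partial>lborel)}
     \<in> sets (lborel \<Otimes>\<^sub>M lborel)"
    by measurable
  from lborel_pair.AE_commute[OF this, simplified] show ?thesis
    using AE_difference_eq_integral_of_weak_derivative[OF assms] by simp
qed

section \<open>Functions on open subsets of the real line\<close>

lemma integral_lebesgue_on_borel:
  fixes f :: "'a::euclidean_space \<Rightarrow> real"
  assumes "S \<in> sets borel" "f \<in> borel_measurable borel"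
  shows "(\<integral>x. f x \<partial>lebesgue_on S) = (\<integral>x. indicator S x * f x \<partial>lborel)"
  using assms by (simp add: integral_restrict_space integral_completion)

lemma integrable_lebesgue_on_borel:
  fixes f :: "'a::euclidean_space \<Rightarrow> real"
  assumes "S \<in> sets borel" "f \<in> borel_measurable borel"
  shows "integrable (lebesgue_on S) f \<longleftrightarrow> integrable lborel (\<lambda>x. indicator S x * f x)"
  using assms by (simp add: integrable_restrict_space integrable_completion)

lemma L2_borel_iff:
  fixes f :: "'a::euclidean_space \<Rightarrow> real"
  assumes "S \<in> sets borel" "f \<in> borel_measurable borel"
  shows "f \<in> L2 S \<longleftrightarrow> integrable lborel (\<lambda>x. indicator S x * (f x)\<^sup>2)"
proof -
  have "f \<in> borel_measurable (lebesgue_on S)"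
    using assms(2) by (intro measurable_restrict_space1 measurable_completion) simp
  then show ?thesis
    using integrable_lebesgue_on_borel[OF assms(1), of "\<lambda>x. (f x)\<^sup>2"] assms(2) by (simp add: L2_def)
qed

text \<open>
  Integrating from \<open>- \<infinity>\<close>, with \<open>v\<close> extended by \<open>0\<close> outside the open set of interest, gives one
  function for all components. It is continuous on the whole line, hence in particular up to the
  end points of the components.
\<close>

definition primitive :: "(real \<Rightarrow> real) \<Rightarrow> real \<Rightarrow> real" where
  "primitive v s = (\<integral>t. indicator {..s} t * v t \<partial>lborel)"

lemma primitive_diff:
  assumes v: "integrable lborel v" and "a \<le> b"
  shows "primitive v b - primitive v a = (\<integral>t. indicator {a..b} t * v t \<partial>lborel)"
proof -
  have int: "integrable lborel (\<lambda>t. indicator A t * v t)" if "A \<in> sets borel" for A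
    using integrable_mult_indicator[OF _ v, of A] that by simp
  have [measurable]: "v \<in> borel_measurable borel"
    using v by auto
  have "primitive v b - primitive v a = (\<integral>t. indicator {..b} t * v t - indicator {..a} t * v t \<partial>lborel)"
    unfolding primitive_def by (rule Bochner_Integration.integral_diff[symmetric]) (auto intro: int)
  also have "\<dots> = (\<integral>t. indicator {a..b} t * v t \<partial>lborel)"
  proof (rule integral_cong_AE)
    show "AE t in lborel. indicator {..b} t * v t - indicator {..a} t * v t = indicator {a..b} t * v t"
      using AE_lborel_singleton[of a] by eventually_elim (use \<open>a \<le> b\<close> in \<open>auto simp: indicator_def\<close>)
  qed auto
  finally show ?thesis .
qed

text \<open>
  The integral over the unit interval covers both signs of \<open>h\<close> and has the shape in which the
  difference identity appears in higher dimension.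
\<close>

lemma primitive_diff_scaled:
  assumes v: "integrable lborel v"
  shows "primitive v (s + h) - primitive v s = h * (\<integral>t. indicator {0..1} t * v (s + t * h) \<partial>lborel)"
proof -
  consider "h = 0" | "h > 0" | "h < 0" by linarith
  then show ?thesis
  proof cases
    case 2
    have "indicator {s..s + h} (s + h * t) = (indicator {0..1} t :: real)" for t
      using 2 by (auto simp: indicator_def zero_le_mult_iff mult_le_cancel_left1)
    then show ?thesis
      using 2 lborel_integral_real_affine[of h "\<lambda>t. indicator {s..s + h} t * v t" s]
      by (simp add: primitive_diff[OF v] mult.commute)
  next
    case 3
    have "indicator {s + h..s} (s + h * t) = (indicator {0..1} t :: real)" for t
      using 3 by (auto simp: indicator_def mult_le_0_iff mult_le_cancel_left1)
    then show ?thesis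
      using 3 lborel_integral_real_affine[of h "\<lambda>t. indicator {s + h..s} t * v t" s]
        primitive_diff[OF v, of "s + h" s]
      by (simp add: mult.commute)
  qed simp
qed

lemma continuous_on_primitive:
  assumes v: "integrable lborel v"
  shows "continuous_on UNIV (primitive v)"
proof (rule continuous_on_sequentiallyI, goal_cases)
  case (1 X s)
  have [measurable]: "v \<in> borel_measurable borel"
    using v by auto
  show "(\<lambda>n. primitive v (X n)) \<longlonglongrightarrow> primitive v s"
    unfolding primitive_def
  proof (rule integral_dominated_convergence[where w = "\<lambda>t. \<bar>v t\<bar>"])
    show "AE t in lborel. (\<lambda>n. indicator {..X n} t * v t) \<longlonglongrightarrow> indicator {..s} t * v t"
      using AE_lborel_singleton[of s]
    proof eventually_elim
      case (elim t)
      have "\<forall>\<^sub>F n in sequentially. indicator {..X n} t * v t = indicator {..s} t * v t"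
      proof (cases "t < s")
        case True
        from order_tendstoD(1)[OF 1(3) True] show ?thesis
          by eventually_elim (use True in auto)
      next
        case False
        with elim have "s < t" by simp
        from order_tendstoD(2)[OF 1(3) this] show ?thesis
          by eventually_elim (use \<open>s < t\<close> in auto)
      qed
      then show ?case
        by (rule tendsto_eventually)
    qed
  qed (use v in \<open>auto simp: indicator_def\<close>)
qed

lemma integrable_product_of_integrable:
  fixes f g :: "real \<Rightarrow> real"
  assumes f: "integrable lborel f" and g: "integrable lborel g"
  shows "integrable (lborel \<Otimes>\<^sub>M lborel) (\<lambda>(s, t). f s * g t)"
proof -
  have [measurable]: "f \<in> borel_measurable borel" "g \<in> borel_measurable borel"
    using f g by auto
  show ?thesis
    by (rule lborel_pair.Fubini_integrable) (use f g in \<open>auto simp: abs_mult\<close>)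
qed

text \<open>
  The complement of the support is open, so the function is constant near each of its points.
\<close>

lemma test_function_vanishes_outside_support:
  assumes "x \<notin> closure {x. \<phi> x \<noteq> 0}"
  shows "\<phi> x = 0" "gradient \<phi> x = 0"
proof -
  define N where "N = - closure {x. \<phi> x \<noteq> 0}"
  have N: "open N" "x \<in> N" "\<And>y. y \<in> N \<Longrightarrow> \<phi> y = 0"
    using assms closure_subset[of "{x. \<phi> x \<noteq> 0}"] by (auto simp: N_def)
  then show "\<phi> x = 0" by auto
  have "(\<phi> has_derivative (\<lambda>_. 0)) (at x)"
    by (rule has_derivative_transform_within_open[where f = "\<lambda>_. 0" and s = N]) (use N in auto)
  then show "gradient \<phi> x = 0"
    by (simp add: gradient_def partial_deriv_eq)
qed

lemma test_function_real_derivative: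
  fixes \<phi> :: "real \<Rightarrow> real"
  assumes "\<phi> \<in> test_functions S"
  shows "(\<phi> has_real_derivative gradient \<phi> x) (at x)"
    and "continuous_on UNIV (gradient \<phi>)"
proof -
  have C: "C_k (Suc 0) \<phi>"
    using assms unfolding test_functions_def by blast
  show "(\<phi> has_real_derivative gradient \<phi> x) (at x)"
    using C_k_Suc_has_derivative_gradient[OF C, of x] by (simp add: has_field_derivative_def mult_commute_abs)
  show "continuous_on UNIV (gradient \<phi>)"
    using continuous_on_gradient[OF C, of 1] by simp
qed

lemma test_function_support_bound:
  fixes \<phi> :: "real \<Rightarrow> real"
  assumes "\<phi> \<in> test_functions S"
  obtains R where "closure {x. \<phi> x \<noteq> 0} \<subseteq> {-R<..<R}"
proof -
  have "bounded (closure {x. \<phi> x \<noteq> 0})"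
    using assms compact_imp_bounded unfolding test_functions_def by blast
  then obtain R where R: "\<And>x. x \<in> closure {x. \<phi> x \<noteq> 0} \<Longrightarrow> \<bar>x\<bar> \<le> R"
    by (auto simp: bounded_iff)
  show ?thesis
    by (rule that[of "max R 0 + 1"]) (use R in fastforce)
qed

text \<open>
  The half-line \<open>{a..}\<close> may be replaced by the bounded interval from \<open>a\<close> to the end of the support.
\<close>

lemma integral_derivative_compact_support:
  fixes f f' :: "real \<Rightarrow> real"
  assumes deriv: "\<And>x. (f has_real_derivative f' x) (at x)" and cont: "continuous_on UNIV f'"
    and supp: "\<And>x. x \<notin> {-R<..<R} \<Longrightarrow> f x = 0" "\<And>x. x \<notin> {-R<..<R} \<Longrightarrow> f' x = 0"
  shows "integrable lborel f'" "(\<integral>x. indicator {a..} x * f' x \<partial>lborel) = - f a"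
    "(\<integral>x. f' x \<partial>lborel) = 0"
proof -
  have isCont: "isCont f' x" for x
    using cont by (simp add: continuous_on_eq_continuous_at)
  have *: "has_bochner_integral lborel (\<lambda>x. indicator {a..} x * f' x) (- f a)" if "a \<le> \<bar>R\<bar>" for a
  proof -
    have "has_bochner_integral lborel (\<lambda>x. f' x * indicator {a..\<bar>R\<bar>} x) (f \<bar>R\<bar> - f a)"
      by (rule has_bochner_integral_FTC_Icc_real) (use that deriv isCont in auto)
    moreover have "f' x * indicator {a..\<bar>R\<bar>} x = indicator {a..} x * f' x" for x
    proof (cases "x \<le> \<bar>R\<bar>")
      case False
      then have "f' x = 0"
        by (intro supp(2)) auto
      then show ?thesis by simp
    qed (auto simp: indicator_def)
    moreover have "f \<bar>R\<bar> = 0"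
      using supp(1) by simp
    ultimately show ?thesis by simp
  qed
  have "indicator {- \<bar>R\<bar>..} x * f' x = f' x" for x
  proof (cases "- \<bar>R\<bar> \<le> x")
    case False
    then have "f' x = 0"
      by (intro supp(2)) auto
    then show ?thesis by simp
  qed (auto simp: indicator_def)
  then have "has_bochner_integral lborel f' (- f (- \<bar>R\<bar>))"
    using *[of "- \<bar>R\<bar>"] by (simp only:)
  moreover have "f (- \<bar>R\<bar>) = 0"
    by (intro supp(1)) auto
  ultimately show "integrable lborel f'" "(\<integral>x. f' x \<partial>lborel) = 0"
    by (auto simp: has_bochner_integral_iff)
  show "(\<integral>x. indicator {a..} x * f' x \<partial>lborel) = - f a"
  proof (cases "a \<le> \<bar>R\<bar>")
    case True
    then show ?thesis
      using * by (simp add: has_bochner_integral_iff)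
  next
    case False
    have eq: "indicator {a..} x * f' x = 0" for x
    proof (cases "a \<le> x")
      case True
      then have "f' x = 0"
        using False by (intro supp(2)) auto
      then show ?thesis by simp
    qed simp
    have "f a = 0"
      using False by (intro supp(1)) auto
    then show ?thesis
      unfolding eq by simp
  qed
qed

text \<open>
  Integration by parts as an exchange of integrals over the half-plane of all \<open>(s, t)\<close> with
  \<open>t \<le> s\<close>; the inner integral of \<open>\<phi>'\<close> over \<open>{t..}\<close> is \<open>- \<phi> t\<close>.
\<close>

lemma primitive_weak_derivative:
  assumes v: "integrable lborel v" and \<phi>: "\<phi> \<in> test_functions S"
  shows "integrable lborel (\<lambda>s. primitive v s * gradient \<phi> s)"
    and "(\<integral>s. primitive v s * gradient \<phi> s \<partial>lborel) = - (\<integral>t. v t * \<phi> t \<partial>lborel)"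
proof -
  obtain R where R: "closure {x. \<phi> x \<noteq> 0} \<subseteq> {-R<..<R}"
    using test_function_support_bound[OF \<phi>] by blast
  have supp: "\<phi> x = 0" "gradient \<phi> x = 0" if "x \<notin> {-R<..<R}" for x
    using that R test_function_vanishes_outside_support[of x \<phi>] by blast+
  have ftc: "integrable lborel (gradient \<phi>)" "(\<integral>s. indicator {t..} s * gradient \<phi> s \<partial>lborel) = - \<phi> t" for t
    using integral_derivative_compact_support(1,2)[OF test_function_real_derivative[OF \<phi>], of R] supp
    by blast+
  have [measurable]: "v \<in> borel_measurable borel" "gradient \<phi> \<in> borel_measurable borel"
    using v ftc(1) by auto
  have int: "integrable (lborel \<Otimes>\<^sub>M lborel) (\<lambda>(s, t). indicator {t..} s * gradient \<phi> s * v t)"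
  proof (rule Bochner_Integration.integrable_bound[OF integrable_product_of_integrable[OF ftc(1) v]])
    have "(\<lambda>z. if snd z \<le> fst z then gradient \<phi> (fst z) * v (snd z) else 0)
        \<in> borel_measurable (lborel \<Otimes>\<^sub>M lborel)"
      by measurable
    also have "(\<lambda>z. if snd z \<le> fst z then gradient \<phi> (fst z) * v (snd z) else 0)
        = (\<lambda>(s, t). indicator {t..} s * gradient \<phi> s * v t)"
      by (auto simp: indicator_def fun_eq_iff)
    finally show "(\<lambda>(s, t). indicator {t..} s * gradient \<phi> s * v t) \<in> borel_measurable (lborel \<Otimes>\<^sub>M lborel)" .
  qed (auto simp: indicator_def split_beta)
  have eq: "(\<integral>t. indicator {t..} s * gradient \<phi> s * v t \<partial>lborel) = primitive v s * gradient \<phi> s" for s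
  proof -
    have eq: "indicator {t..} s * gradient \<phi> s * v t = indicator {..s} t * v t * gradient \<phi> s" for t
      by (simp add: indicator_def)
    show ?thesis
      unfolding primitive_def eq by (rule integral_mult_left_zero)
  qed
  show "integrable lborel (\<lambda>s. primitive v s * gradient \<phi> s)"
    using lborel_pair.integrable_fst[OF int] by (simp add: eq)
  have "(\<integral>s. primitive v s * gradient \<phi> s \<partial>lborel)
      = (\<integral>t. (\<integral>s. indicator {t..} s * gradient \<phi> s * v t \<partial>lborel) \<partial>lborel)"
    using lborel_pair.Fubini_integral[OF int] by (simp add: eq)
  also have "\<dots> = - (\<integral>t. v t * \<phi> t \<partial>lborel)"
  proof -
    have "(\<integral>s. indicator {t..} s * gradient \<phi> s * v t \<partial>lborel) = - (v t * \<phi> t)" for t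
      by (subst integral_mult_left_zero) (simp add: ftc(2)[of t])
    then show ?thesis
      by (simp only: Bochner_Integration.integral_minus)
  qed
  finally show "(\<integral>s. primitive v s * gradient \<phi> s \<partial>lborel) = - (\<integral>t. v t * \<phi> t \<partial>lborel)" .
qed

text \<open>
  Near a point of \<open>S\<close> the function \<open>c\<close> is constant, and near any other point \<open>\<phi>\<close> vanishes. So \<open>c \<phi>\<close> is
  differentiable on the whole line with continuous derivative \<open>c \<phi>'\<close>, whose integral is \<open>0\<close>.
\<close>

lemma locally_constant_weak_derivative:
  fixes S :: "real set" and \<kappa> :: "real set \<Rightarrow> real"
  defines "c \<equiv> \<lambda>s. \<kappa> (connected_component_set S s)"
  assumes S: "open S" and \<phi>: "\<phi> \<in> test_functions S"
  shows "integrable lborel (\<lambda>s. c s * gradient \<phi> s)"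
    and "(\<integral>s. c s * gradient \<phi> s \<partial>lborel) = 0"
proof -
  obtain R where R: "closure {x. \<phi> x \<noteq> 0} \<subseteq> {-R<..<R}"
    using test_function_support_bound[OF \<phi>] by blast
  have supp: "\<phi> x = 0" "gradient \<phi> x = 0" if "x \<notin> {-R<..<R}" for x
    using that R test_function_vanishes_outside_support[of x \<phi>] by blast+
  note d = test_function_real_derivative[OF \<phi>]
  have local: "\<exists>N k. open N \<and> x \<in> N \<and> (\<forall>y\<in>N. c y * \<phi> y = k * \<phi> y \<and> c y * gradient \<phi> y = k * gradient \<phi> y)" for x
  proof (cases "x \<in> S")
    case True
    have eq: "c y = c x" if "y \<in> connected_component_set S x" for y
      using connected_component_eq[OF that] by (simp add: c_def)
    show ?thesis
    proof (intro exI conjI ballI)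
      show "open (connected_component_set S x)"
        using S by (rule open_connected_component)
      show "x \<in> connected_component_set S x"
        using True by (simp add: connected_component_refl)
    qed (simp_all only: eq)
  next
    case False
    show ?thesis
    proof (intro exI conjI ballI)
      show "open (- closure {x. \<phi> x \<noteq> 0})"
        by (intro open_Compl closed_closure)
      show "x \<in> - closure {x. \<phi> x \<noteq> 0}"
        using False \<phi> unfolding test_functions_def by blast
      fix y assume "y \<in> - closure {x. \<phi> x \<noteq> 0}"
      then have "\<phi> y = 0" "gradient \<phi> y = 0"
        using test_function_vanishes_outside_support[of y \<phi>] by blast+
      then show "c y * \<phi> y = 0 * \<phi> y" "c y * gradient \<phi> y = 0 * gradient \<phi> y"
        by simp_all
    qed
  qed
  have deriv: "((\<lambda>s. c s * \<phi> s) has_real_derivative c x * gradient \<phi> x) (at x)" for x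
  proof -
    obtain N k where N: "open N" "x \<in> N"
      "\<And>y. y \<in> N \<Longrightarrow> c y * \<phi> y = k * \<phi> y" "\<And>y. y \<in> N \<Longrightarrow> c y * gradient \<phi> y = k * gradient \<phi> y"
      using local[of x] by blast
    have "((\<lambda>s. k * \<phi> s) has_real_derivative k * gradient \<phi> x) (at x)"
      by (intro DERIV_cmult d)
    then have "((\<lambda>s. c s * \<phi> s) has_real_derivative k * gradient \<phi> x) (at x)"
      by (rule has_field_derivative_transform_within_open[OF _ N(1,2) N(3)[symmetric]])
    then show ?thesis
      unfolding N(4)[OF N(2)] .
  qed
  have cont: "continuous_on UNIV (\<lambda>s. c s * gradient \<phi> s)"
    unfolding continuous_on_eq_continuous_at[OF open_UNIV]
  proof
    fix x
    obtain N k where N: "open N" "x \<in> N" "\<And>y. y \<in> N \<Longrightarrow> c y * gradient \<phi> y = k * gradient \<phi> y"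
      using local[of x] by blast
    have "continuous_on N (\<lambda>s. k * gradient \<phi> s)"
      by (intro continuous_intros continuous_on_subset[OF d(2)]) auto
    then have "continuous_on N (\<lambda>s. c s * gradient \<phi> s)"
      by (rule continuous_on_eq) (rule N(3)[symmetric])
    then show "isCont (\<lambda>s. c s * gradient \<phi> s) x"
      using continuous_on_eq_continuous_at[OF N(1)] N(2) by blast
  qed
  show "integrable lborel (\<lambda>s. c s * gradient \<phi> s)" "(\<integral>s. c s * gradient \<phi> s \<partial>lborel) = 0"
    using integral_derivative_compact_support[OF deriv cont, of R] supp by auto
qed

lemma weak_derivative_primitive_plus_locally_constant:
  fixes u v :: "real \<Rightarrow> real" and \<kappa> :: "real set \<Rightarrow> real"
  assumes [measurable]: "u \<in> borel_measurable borel" and v: "integrable lborel v" and S: "open S"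
    and u: "AE s in lborel. s \<in> S \<longrightarrow> u s = primitive v s + \<kappa> (connected_component_set S s)"
  shows "weak_dir_deriv S 1 u v"
  unfolding weak_dir_deriv_def
proof
  fix \<phi> assume \<phi>: "\<phi> \<in> test_functions S"
  have [measurable]: "v \<in> borel_measurable borel" "S \<in> sets borel"
    using v S by auto
  have "continuous_on UNIV \<phi>" "continuous_on UNIV (gradient \<phi>)"
    using test_function_real_derivative[OF \<phi>] by (auto intro: DERIV_continuous_on)
  then have [measurable]: "\<phi> \<in> borel_measurable borel" "gradient \<phi> \<in> borel_measurable borel"
    by (auto intro: borel_measurable_continuous_onI)
  have supp: "\<phi> x = 0" "gradient \<phi> x = 0" if "x \<notin> S" for x
    using that \<phi> test_function_vanishes_outside_support[of x \<phi>] by (auto simp: test_functions_def)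
  let ?c = "\<lambda>s. \<kappa> (connected_component_set S s)"
  note P = primitive_weak_derivative[OF v \<phi>]
  note C = locally_constant_weak_derivative[OF S \<phi>, of \<kappa>]
  have "(\<integral>x. u x * (1 \<bullet> gradient \<phi> x) \<partial>lebesgue_on S) = (\<integral>x. indicator S x * (u x * gradient \<phi> x) \<partial>lborel)"
    by (simp add: integral_lebesgue_on_borel)
  also have "\<dots> = (\<integral>x. primitive v x * gradient \<phi> x + ?c x * gradient \<phi> x \<partial>lborel)"
  proof (rule integral_cong_AE)
    show "(\<lambda>x. primitive v x * gradient \<phi> x + ?c x * gradient \<phi> x) \<in> borel_measurable lborel"
      using P(1) C(1) by (intro borel_measurable_add borel_measurable_integrable)
    show "AE x in lborel. indicator S x * (u x * gradient \<phi> x)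
        = primitive v x * gradient \<phi> x + ?c x * gradient \<phi> x"
      using u by eventually_elim (auto simp: indicator_def supp distrib_right)
  qed measurable
  also have "\<dots> = - (\<integral>x. v x * \<phi> x \<partial>lborel)"
    using P C by simp
  also have "(\<integral>x. v x * \<phi> x \<partial>lborel) = (\<integral>x. indicator S x * (v x * \<phi> x) \<partial>lborel)"
    by (rule Bochner_Integration.integral_cong) (auto simp: indicator_def supp)
  also have "\<dots> = (\<integral>x. v x * \<phi> x \<partial>lebesgue_on S)"
    by (simp add: integral_lebesgue_on_borel)
  finally show "(\<integral>x. u x * (1 \<bullet> gradient \<phi> x) \<partial>lebesgue_on S) = - (\<integral>x. v x * \<phi> x \<partial>lebesgue_on S)" .
qed

text \<open>
  In each component pick one base point for which the identity holds for almost every increment;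
  it compares \<open>u\<close> with \<open>primitive v\<close> at almost every other point of that component. There are only
  countably many components, so the exceptional sets add up to a null set.
\<close>

lemma AE_eq_primitive_plus_locally_constant:
  fixes u v :: "real \<Rightarrow> real"
  assumes v: "integrable lborel v" and S: "open S"
    and diff: "AE s in lborel. AE h in lborel. (\<forall>t\<in>{0..1}. s + t * h \<in> S) \<longrightarrow>
       u (s + h) - u s = h * (\<integral>t. indicator {0..1} t * v (s + t * h) \<partial>lborel)"
  shows "\<exists>\<kappa>. AE s in lborel. s \<in> S \<longrightarrow> u s = primitive v s + \<kappa> (connected_component_set S s)"
proof -
  have "\<exists>k. AE s in lborel. s \<in> I \<longrightarrow> u s = primitive v s + k" if I: "I \<in> components S" for I
  proof -
    have "open I" "I \<noteq> {}" "I \<subseteq> S" "convex I"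
      using open_components[OF S I] in_components_nonempty[OF I] in_components_subset[OF I]
        in_components_connected[OF I]
      by (simp_all add: is_interval_connected_1[symmetric] is_interval_convex_1[symmetric])
    let ?Q = "\<lambda>s h. (\<forall>t\<in>{0..1}. s + t * h \<in> S) \<longrightarrow>
       u (s + h) - u s = h * (\<integral>t. indicator {0..1} t * v (s + t * h) \<partial>lborel)"
    obtain s0 where s0: "s0 \<in> I" "AE h in lborel. ?Q s0 h"
    proof (rule ccontr)
      assume "\<not> thesis"
      then have "\<And>s. s \<in> I \<Longrightarrow> \<not> (AE h in lborel. ?Q s h)"
        using that by blast
      with diff have "AE s in lborel. s \<notin> I"
        by (auto elim: eventually_mono)
      then have "negligible I"
        using \<open>open I\<close> by (simp add: negligible_iff_null_sets AE_iff_null_sets AE_completion_iff)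
      with open_not_negligible \<open>open I\<close> \<open>I \<noteq> {}\<close> show False
        by blast
    qed
    have "AE h in distr lborel borel ((+) (- s0)). ?Q s0 h"
      using s0(2) by (simp only: lborel_distr_plus)
    then have "AE s in lborel. ?Q s0 (- s0 + s)"
      by (rule AE_distrD[rotated]) simp
    then have "AE s in lborel. s \<in> I \<longrightarrow> u s = primitive v s + (u s0 - primitive v s0)"
    proof eventually_elim
      case (elim s)
      show ?case
      proof
        assume s: "s \<in> I"
        have "s0 + t * (- s0 + s) \<in> S" if "t \<in> {0..1}" for t
        proof -
          have "(1 - t) *\<^sub>R s0 + t *\<^sub>R s \<in> I"
            using \<open>convex I\<close> s0(1) s that by (intro convexD_alt) auto
          then show ?thesis
            using \<open>I \<subseteq> S\<close> by (auto simp: algebra_simps)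
        qed
        with elim show "u s = primitive v s + (u s0 - primitive v s0)"
          using primitive_diff_scaled[OF v, of s0 "- s0 + s"] by simp
      qed
    qed
    then show ?thesis ..
  qed
  then obtain \<kappa> where \<kappa>: "\<And>I. I \<in> components S \<Longrightarrow> AE s in lborel. s \<in> I \<longrightarrow> u s = primitive v s + \<kappa> I"
    by metis
  have "countable (components S)"
    using S by (intro countable_disjoint_open_subsets)
      (auto intro: open_components simp: pairwise_def disjnt_def components_nonoverlap)
  with \<kappa> have "AE s in lborel. \<forall>I\<in>components S. s \<in> I \<longrightarrow> u s = primitive v s + \<kappa> I"
    by (intro AE_ball_countable') auto
  then have "AE s in lborel. s \<in> S \<longrightarrow> u s = primitive v s + \<kappa> (connected_component_set S s)"
    by eventually_elim (auto simp: components_def connected_component_refl)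
  then show ?thesis
    by (intro exI[of _ \<kappa>])
qed

section \<open>Slicing Lebesgue measure along a direction\<close>

lemma nn_integral_translate:
  fixes f :: "'a::euclidean_space \<Rightarrow> ennreal"
  assumes "f \<in> borel_measurable borel"
  shows "(\<integral>\<^sup>+x. f (c + x) \<partial>lborel) = (\<integral>\<^sup>+x. f x \<partial>lborel)"
proof -
  have "(\<integral>\<^sup>+x. f x \<partial>lborel) = (\<integral>\<^sup>+x. f x \<partial>distr lborel borel ((+) c))"
    by (simp only: lborel_distr_plus)
  also have "\<dots> = (\<integral>\<^sup>+x. f (c + x) \<partial>lborel)"
    using assms by (subst nn_integral_distr) auto
  finally show ?thesis by simp
qed

lemma nn_integral_reflect:
  fixes f :: "'a::euclidean_space \<Rightarrow> ennreal"
  assumes [measurable]: "f \<in> borel_measurable borel"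
  shows "(\<integral>\<^sup>+x. f (c - x) \<partial>lborel) = (\<integral>\<^sup>+x. f x \<partial>lborel)"
proof -
  have "distr lborel borel (\<lambda>x. c - x) = lborel"
    using lborel_affine[of "- 1" c] by (simp add: density_1)
  then have "(\<integral>\<^sup>+x. f x \<partial>lborel) = (\<integral>\<^sup>+x. f x \<partial>distr lborel borel (\<lambda>x. c - x))"
    by (simp only:)
  also have "\<dots> = (\<integral>\<^sup>+x. f (c - x) \<partial>lborel)"
    by (subst nn_integral_distr) auto
  finally show ?thesis by simp
qed

lemma orthogonal_transformation_vimage_ball:
  fixes T :: "'a::euclidean_space \<Rightarrow> 'a"
  assumes "orthogonal_transformation T"
  shows "T -` ball 0 r = ball 0 r"
  using orthogonal_transformation_norm[OF assms] by auto

text \<open>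
  The argument for uniqueness of Haar measure. With \<open>\<mu> C\<close> the Lebesgue measure of the preimage of
  \<open>C\<close> under \<open>T\<close>, integrate over all pairs \<open>(x, y)\<close> with \<open>T x \<in> A\<close> and \<open>T x + y \<in> B\<close>. Integrating
  first over \<open>y\<close> yields \<open>\<mu> A\<close> times the measure of \<open>B\<close>. Translating \<open>x\<close> by the preimage of \<open>- y\<close>
  first yields the measure of \<open>A\<close> times \<open>\<mu> B\<close>. For the unit ball \<open>B\<close> the two factors from \<open>B\<close> agree,
  because \<open>T\<close> preserves balls, and they cancel.
\<close>

lemma distr_lborel_orthogonal_transformation:
  fixes T :: "'a::euclidean_space \<Rightarrow> 'a"
  assumes T: "orthogonal_transformation T"
  shows "distr lborel borel T = lborel"
proof (rule measure_eqI)
  have lin: "linear T"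
    using T by (rule orthogonal_transformation_linear)
  then have "continuous_on UNIV T"
    by (simp add: linear_continuous_on linear_conv_bounded_linear)
  then have [measurable]: "T \<in> borel_measurable borel"
    by (rule borel_measurable_continuous_onI)
  define B :: "'a set" where "B = ball 0 1"
  have [measurable]: "B \<in> sets borel"
    by (simp add: B_def)
  fix A assume "A \<in> sets (distr lborel borel T)"
  then have [measurable]: "A \<in> sets borel" by simp
  define W where "W = inv T"
  have W: "T (W y) = y" for y
    using orthogonal_transformation_surj[OF T] by (simp add: W_def surj_f_inv_f)
  have diff: "T (- W y + x) = T x - y" for x y
    using linear_diff[OF lin, of x "W y"] W by simp
  have meas: "emeasure lborel (T -` C) = (\<integral>\<^sup>+x. indicator C (T x) \<partial>lborel)" if "C \<in> sets borel" for C
  proof -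
    have "T -` C \<in> sets borel"
      using measurable_sets_borel[OF \<open>T \<in> borel_measurable borel\<close> that] by simp
    then have "emeasure lborel (T -` C) = (\<integral>\<^sup>+x. indicator (T -` C) x \<partial>lborel)"
      by simp
    then show ?thesis
      by (simp only: indicator_vimage[abs_def] o_def)
  qed
  have "emeasure lborel (T -` A) * emeasure lborel B
      = (\<integral>\<^sup>+x. indicator A (T x) * (\<integral>\<^sup>+y. indicator B (T x + y) \<partial>lborel) \<partial>lborel)"
    by (subst nn_integral_translate[of "indicator B"]) (simp_all add: nn_integral_multc meas)
  also have "\<dots> = (\<integral>\<^sup>+x. (\<integral>\<^sup>+y. indicator A (T x) * indicator B (T x + y) \<partial>lborel) \<partial>lborel)"
    by (simp add: nn_integral_cmult)
  also have "\<dots> = (\<integral>\<^sup>+y. (\<integral>\<^sup>+x. indicator A (T x) * indicator B (T x + y) \<partial>lborel) \<partial>lborel)"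
    by (rule lborel_pair.Fubini') measurable
  also have "\<dots> = (\<integral>\<^sup>+y. (\<integral>\<^sup>+x. indicator A (T x - y) * indicator B (T x) \<partial>lborel) \<partial>lborel)"
  proof (rule nn_integral_cong)
    fix y :: 'a
    have "(\<integral>\<^sup>+x. indicator A (T (- W y + x)) * indicator B (T (- W y + x) + y) \<partial>lborel)
        = (\<integral>\<^sup>+x. indicator A (T x) * (indicator B (T x + y) :: ennreal) \<partial>lborel)"
      by (rule nn_integral_translate[of "\<lambda>x. indicator A (T x) * indicator B (T x + y)"]) measurable
    then show "(\<integral>\<^sup>+x. indicator A (T x) * indicator B (T x + y) \<partial>lborel)
        = (\<integral>\<^sup>+x. indicator A (T x - y) * (indicator B (T x) :: ennreal) \<partial>lborel)"
      unfolding diff by simp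
  qed
  also have "\<dots> = (\<integral>\<^sup>+x. (\<integral>\<^sup>+y. indicator A (T x - y) * indicator B (T x) \<partial>lborel) \<partial>lborel)"
    by (rule lborel_pair.Fubini') measurable
  also have "\<dots> = (\<integral>\<^sup>+x. (\<integral>\<^sup>+y. indicator A (T x - y) \<partial>lborel) * indicator B (T x) \<partial>lborel)"
    by (simp add: nn_integral_multc)
  also have "\<dots> = emeasure lborel A * emeasure lborel (T -` B)"
    by (subst nn_integral_reflect[of "indicator A"]) (simp_all add: nn_integral_cmult meas)
  also have "T -` B = B"
    unfolding B_def by (rule orthogonal_transformation_vimage_ball[OF T])
  finally have "emeasure lborel (T -` A) * emeasure lborel B = emeasure lborel A * emeasure lborel B" .
  then have "emeasure lborel B * emeasure lborel (T -` A) = emeasure lborel B * emeasure lborel A"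
    by (metis mult.commute)
  moreover have "emeasure lborel B \<noteq> \<infinity>"
    unfolding B_def using emeasure_bounded_finite[OF bounded_ball[of 0 1]] by (simp add: less_top)
  moreover have "emeasure lborel B \<noteq> 0"
  proof
    assume "emeasure lborel B = 0"
    then have "negligible B"
      by (simp add: negligible_iff_null_sets null_sets_completion_iff null_sets_def)
    then show False
      using open_not_negligible[of B] by (simp add: B_def)
  qed
  ultimately have "emeasure lborel (T -` A) = emeasure lborel A"
    by (simp add: ennreal_mult_cancel_left)
  then show "emeasure (distr lborel borel T) A = emeasure lborel A"
    by (simp add: emeasure_distr)
qed simp

text \<open>
  The difference of both sides is orthogonal to \<open>E\<close>, hence to everything, itself included.
\<close>

lemma orthonormal_expansion:
  fixes E :: "'a::euclidean_space set"
  assumes "pairwise orthogonal E" "\<And>b. b \<in> E \<Longrightarrow> norm b = 1" "span E = UNIV"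
  shows "(\<Sum>b\<in>E. (x \<bullet> b) *\<^sub>R b) = x"
proof -
  have fin: "finite E"
    using assms(1) by (rule pairwise_orthogonal_imp_finite)
  define r where "r = x - (\<Sum>b\<in>E. (x \<bullet> b) *\<^sub>R b)"
  have "orthogonal r c" if "c \<in> E" for c
  proof -
    have "(\<Sum>b\<in>E. (x \<bullet> b) * (b \<bullet> c)) = (\<Sum>b\<in>E. if b = c then x \<bullet> c else 0)"
      using assms(1,2) that
      by (intro sum.cong) (auto simp: pairwise_def orthogonal_def norm_eq_1)
    then show ?thesis
      using fin that by (simp add: r_def orthogonal_def inner_diff_left inner_sum_left)
  qed
  then have "orthogonal r r"
    using orthogonal_to_span[of r E r] assms(3) by simp
  then show ?thesis
    by (simp add: orthogonal_self r_def)
qed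

lemma space_hyperplane_lborel [simp]: "space (hyperplane_lborel \<theta>) = hyperplane \<theta>"
  by (simp add: hyperplane_lborel_def Let_def space_restrict_space)

lemma sets_hyperplane_lborel [measurable_cong]:
  "sets (hyperplane_lborel \<theta>) = sets (restrict_space borel (hyperplane \<theta>))"
  by (simp add: hyperplane_lborel_def Let_def)

lemma measurable_along_direction:
  "(\<lambda>(y, s). s *\<^sub>R \<theta> + y) \<in> borel_measurable (hyperplane_lborel \<theta> \<Otimes>\<^sub>M lborel)"
proof -
  have id: "(\<lambda>y. y) \<in> borel_measurable (hyperplane_lborel \<theta>)"
    by (subst measurable_cong_sets[OF sets_hyperplane_lborel refl]) (simp add: measurable_restrict_space1)
  have "(\<lambda>z. fst z) \<in> borel_measurable (hyperplane_lborel \<theta> \<Otimes>\<^sub>M (lborel :: real measure))"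
    using measurable_compose[OF measurable_fst id] .
  moreover have "(\<lambda>z. snd z) \<in> borel_measurable (hyperplane_lborel \<theta> \<Otimes>\<^sub>M (lborel :: real measure))"
    using measurable_snd[of "hyperplane_lborel \<theta>" "lborel :: real measure"] by simp
  ultimately show ?thesis
    unfolding split_beta by (intro borel_measurable_add borel_measurable_scaleR) auto
qed

text \<open>
  The basis is existentially quantified because the measure is built from a chosen one; its
  values on rectangles along that basis suffice to identify the product with the line measure.
\<close>

lemma emeasure_hyperplane_lborel_rectangle:
  fixes \<theta> :: "'a::euclidean_space"
  shows "\<exists>B. orthonormal_basis_of (hyperplane \<theta>) B \<and>
    (\<forall>l u. (\<forall>b\<in>B. l b \<le> u b) \<longrightarrow>
      {y \<in> hyperplane \<theta>. \<forall>b\<in>B. l b < y \<bullet> b \<and> y \<bullet> b < u b} \<in> sets (hyperplane_lborel \<theta>) \<and>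
      emeasure (hyperplane_lborel \<theta>) {y \<in> hyperplane \<theta>. \<forall>b\<in>B. l b < y \<bullet> b \<and> y \<bullet> b < u b}
        = ennreal (\<Prod>b\<in>B. u b - l b))"
proof -
  define B where "B = (SOME B. orthonormal_basis_of (hyperplane \<theta>) B)"
  have B: "orthonormal_basis_of (hyperplane \<theta>) B"
    unfolding B_def using orthonormal_basis_of_hyperplane_exists by (rule someI_ex)
  then have fin: "finite B"
    by (auto simp: orthonormal_basis_of_def intro: pairwise_orthogonal_imp_finite)
  define e where "e c = (\<Sum>b\<in>B. c b *\<^sub>R b)" for c :: "'a \<Rightarrow> real"
  have H: "hyperplane_lborel \<theta> = distr (\<Pi>\<^sub>M b\<in>B. lborel) (restrict_space borel (hyperplane \<theta>)) e"
    by (simp add: hyperplane_lborel_def B_def[symmetric] e_def[abs_def] Let_def)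
  have "e c \<in> span B" for c
    unfolding e_def by (intro span_sum span_scale span_base)
  then have e_hyp: "e c \<in> hyperplane \<theta>" for c
    using B by (simp add: orthonormal_basis_of_def)
  then have e_meas: "e \<in> measurable (\<Pi>\<^sub>M b\<in>B. lborel) (restrict_space borel (hyperplane \<theta>))"
  proof (intro measurable_restrict_space2)
    show "e \<in> borel_measurable (\<Pi>\<^sub>M b\<in>B. lborel)"
      unfolding e_def by measurable
  qed (use e_hyp in auto)
  have e_inner: "e c \<bullet> b = c b" if "b \<in> B" for c b
  proof -
    have "(\<Sum>b'\<in>B. c b' * (b' \<bullet> b)) = (\<Sum>b'\<in>B. if b' = b then c b else 0)"
      using B that
      by (intro sum.cong) (auto simp: orthonormal_basis_of_def pairwise_def orthogonal_def norm_eq_1)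
    then show ?thesis
      using fin that by (simp add: e_def inner_sum_left)
  qed
  interpret product_sigma_finite "\<lambda>_. lborel :: real measure"
    by standard
  show ?thesis
  proof (intro exI[of _ B] conjI[OF B] allI impI)
    fix l u :: "'a \<Rightarrow> real" assume le: "\<forall>b\<in>B. l b \<le> u b"
    let ?Y = "{y \<in> hyperplane \<theta>. \<forall>b\<in>B. l b < y \<bullet> b \<and> y \<bullet> b < u b}"
    have "open (\<Inter>b\<in>B. {y. l b < y \<bullet> b} \<inter> {y. y \<bullet> b < u b})"
      using fin by (intro open_INT open_Int open_Collect_less continuous_intros ballI)
    moreover have "?Y = hyperplane \<theta> \<inter> (\<Inter>b\<in>B. {y. l b < y \<bullet> b} \<inter> {y. y \<bullet> b < u b})"
      by auto
    ultimately have Y: "?Y \<in> sets (restrict_space borel (hyperplane \<theta>))"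
      unfolding sets_restrict_space by (intro image_eqI) auto
    have "e -` ?Y \<inter> space (\<Pi>\<^sub>M b\<in>B. lborel) = (\<Pi>\<^sub>E b\<in>B. {l b<..<u b})"
      using e_hyp by (auto simp: space_PiM PiE_iff e_inner)
    then have "emeasure (hyperplane_lborel \<theta>) ?Y = (\<Prod>b\<in>B. emeasure lborel {l b<..<u b})"
      using fin by (simp add: H emeasure_distr[OF e_meas Y] emeasure_PiM)
    also have "\<dots> = ennreal (\<Prod>b\<in>B. u b - l b)"
      using le by (simp add: prod_ennreal)
    finally show "?Y \<in> sets (hyperplane_lborel \<theta>) \<and> emeasure (hyperplane_lborel \<theta>) ?Y = ennreal (\<Prod>b\<in>B. u b - l b)"
      using Y by (simp add: sets_hyperplane_lborel)
  qed
qed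

text \<open>
  Together with \<open>\<theta>\<close>, the orthonormal basis of the hyperplane is one of the whole space. The map
  \<open>T\<close> that rotates it onto the standard basis turns the image measure into one whose value on
  every box is the product of its edge lengths, which characterizes Lebesgue measure. Rotating
  back by the inverse \<open>R\<close> preserves Lebesgue measure.
\<close>

theorem lborel_eq_hyperplane_times_line:
  fixes \<theta> :: "'a::euclidean_space"
  assumes \<theta>: "norm \<theta> = 1"
  shows "distr (hyperplane_lborel \<theta> \<Otimes>\<^sub>M lborel) borel (\<lambda>(y, s). s *\<^sub>R \<theta> + y) = lborel"
proof -
  obtain B where B: "orthonormal_basis_of (hyperplane \<theta>) B" and rectangle:
    "\<forall>l u. (\<forall>b\<in>B. l b \<le> u b) \<longrightarrow>
      {y \<in> hyperplane \<theta>. \<forall>b\<in>B. l b < y \<bullet> b \<and> y \<bullet> b < u b} \<in> sets (hyperplane_lborel \<theta>) \<and>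
      emeasure (hyperplane_lborel \<theta>) {y \<in> hyperplane \<theta>. \<forall>b\<in>B. l b < y \<bullet> b \<and> y \<bullet> b < u b}
        = ennreal (\<Prod>b\<in>B. u b - l b)"
    using emeasure_hyperplane_lborel_rectangle[of \<theta>] by (elim exE conjE)
  define E where "E = insert \<theta> B"
  have fin: "finite B"
    using B by (auto simp: orthonormal_basis_of_def intro: pairwise_orthogonal_imp_finite)
  have B_perp: "b \<bullet> \<theta> = 0" "\<theta> \<bullet> b = 0" if "b \<in> B" for b
  proof -
    have "b \<in> hyperplane \<theta>"
      using B that by (auto simp: orthonormal_basis_of_def intro: span_base)
    then show "b \<bullet> \<theta> = 0" "\<theta> \<bullet> b = 0"
      by (auto simp: hyperplane_def inner_commute)
  qed
  have "\<theta> \<bullet> \<theta> = 1"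
    using \<theta> by (simp add: norm_eq_1)
  with B_perp have "\<theta> \<notin> B" by force
  have E_orth: "pairwise orthogonal E" and E_norm: "\<And>b. b \<in> E \<Longrightarrow> norm b = 1"
    using B \<theta> B_perp by (auto simp: E_def orthonormal_basis_of_def pairwise_insert orthogonal_def)
  have E_span: "span E = UNIV"
  proof -
    have "x \<in> span E" for x
    proof -
      have "x - (x \<bullet> \<theta>) *\<^sub>R \<theta> \<in> span B"
        using B \<open>\<theta> \<bullet> \<theta> = 1\<close> by (simp add: orthonormal_basis_of_def hyperplane_def inner_diff_left)
      then show ?thesis
        unfolding E_def span_insert by blast
    qed
    then show ?thesis by blast
  qed
  have "0 \<notin> E"
    using E_norm by force
  then have "independent E"
    using E_orth pairwise_orthogonal_independent by blast
  then have "card E = DIM('a)"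
    using E_span by (metis dim_UNIV dim_eq_card_independent dim_span)
  then obtain \<pi> where \<pi>: "bij_betw \<pi> E (Basis :: 'a set)"
    using finite_same_card_bij[of E "Basis :: 'a set"] fin by (auto simp: E_def)
  have \<pi>_Basis: "\<pi> b \<in> Basis" if "b \<in> E" for b
    using \<pi> that by (auto simp: bij_betw_def)

  define R where "R z = (\<Sum>b\<in>E. (z \<bullet> \<pi> b) *\<^sub>R b)" for z :: 'a
  define T where "T x = (\<Sum>b\<in>E. (x \<bullet> b) *\<^sub>R \<pi> b)" for x :: 'a
  have T_inner: "T x \<bullet> \<pi> b = x \<bullet> b" if "b \<in> E" for x b
  proof -
    have "(\<Sum>c\<in>E. (x \<bullet> c) * (\<pi> c \<bullet> \<pi> b)) = (\<Sum>c\<in>E. if c = b then x \<bullet> b else 0)"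
      using \<pi> that \<pi>_Basis
      by (intro sum.cong) (auto simp: inner_Basis bij_betw_def inj_on_def)
    then show ?thesis
      using fin that by (simp add: T_def inner_sum_left E_def)
  qed
  have RT: "R (T x) = x" for x
    unfolding R_def using orthonormal_expansion[OF E_orth E_norm E_span, of x] by (simp add: T_inner)
  have "orthogonal_transformation R"
    unfolding orthogonal_transformation
  proof safe
    show "linear R"
      unfolding R_def by (intro linear_compose_sum ballI linearI) (auto simp: inner_add_left scaleR_add_left)
    fix z
    have "(norm (R z))\<^sup>2 = (\<Sum>b\<in>E. (norm ((z \<bullet> \<pi> b) *\<^sub>R b))\<^sup>2)"
      unfolding R_def using fin E_orth
      by (intro norm_sum_Pythagorean) (auto simp: E_def pairwise_def orthogonal_def)
    also have "\<dots> = (\<Sum>b\<in>E. (z \<bullet> \<pi> b)\<^sup>2)"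
      by (simp add: E_norm)
    also have "\<dots> = (\<Sum>i\<in>Basis. (z \<bullet> i)\<^sup>2)"
      using \<pi> by (rule sum.reindex_bij_betw)
    also have "\<dots> = (norm z)\<^sup>2"
      unfolding power2_norm_eq_inner by (subst euclidean_inner[of z z]) (simp add: power2_eq_square)
    finally show "norm (R z) = norm z"
      by simp
  qed

  let ?N = "hyperplane_lborel \<theta> \<Otimes>\<^sub>M (lborel :: real measure)"
  note [measurable] = measurable_along_direction[of \<theta>]
  have "continuous_on UNIV T" "continuous_on UNIV R"
    unfolding T_def R_def by (intro continuous_intros)+
  then have [measurable]: "T \<in> borel_measurable borel" "R \<in> borel_measurable borel"
    by (auto intro: borel_measurable_continuous_onI)
  have "lborel = distr ?N borel (\<lambda>(y, s). T (s *\<^sub>R \<theta> + y))"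
  proof (rule lborel_eqI)
    fix l u :: 'a assume le: "\<And>b. b \<in> Basis \<Longrightarrow> l \<bullet> b \<le> u \<bullet> b"
    let ?Y = "{y \<in> hyperplane \<theta>. \<forall>b\<in>B. l \<bullet> \<pi> b < y \<bullet> b \<and> y \<bullet> b < u \<bullet> \<pi> b}"
    have "T x \<in> box l u \<longleftrightarrow> (\<forall>b\<in>E. l \<bullet> \<pi> b < x \<bullet> b \<and> x \<bullet> b < u \<bullet> \<pi> b)" for x
    proof -
      have "T x \<in> box l u \<longleftrightarrow> (\<forall>i\<in>\<pi> ` E. l \<bullet> i < T x \<bullet> i \<and> T x \<bullet> i < u \<bullet> i)"
        using \<pi> by (simp add: mem_box bij_betw_def)
      then show ?thesis
        by (simp add: T_inner)
    qed
    then have eq: "(\<lambda>(y, s). T (s *\<^sub>R \<theta> + y)) -` box l u \<inter> space ?N = ?Y \<times> {l \<bullet> \<pi> \<theta><..<u \<bullet> \<pi> \<theta>}"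
      using B_perp \<open>\<theta> \<bullet> \<theta> = 1\<close>
      by (auto simp: space_pair_measure E_def inner_add_left hyperplane_def)
    have Y: "?Y \<in> sets (hyperplane_lborel \<theta>)"
      "emeasure (hyperplane_lborel \<theta>) ?Y = ennreal (\<Prod>b\<in>B. u \<bullet> \<pi> b - l \<bullet> \<pi> b)"
      using rectangle[rule_format, of "\<lambda>b. l \<bullet> \<pi> b" "\<lambda>b. u \<bullet> \<pi> b"] le \<pi>_Basis by (auto simp: E_def)
    have "emeasure (distr ?N borel (\<lambda>(y, s). T (s *\<^sub>R \<theta> + y))) (box l u) = emeasure ?N (?Y \<times> {l \<bullet> \<pi> \<theta><..<u \<bullet> \<pi> \<theta>})"
      by (subst emeasure_distr) (simp_all add: eq)
    also have "\<dots> = ennreal (\<Prod>b\<in>B. u \<bullet> \<pi> b - l \<bullet> \<pi> b) * ennreal (u \<bullet> \<pi> \<theta> - l \<bullet> \<pi> \<theta>)"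
      using le[of "\<pi> \<theta>"] \<pi>_Basis Y by (simp add: lborel.emeasure_pair_measure_Times E_def)
    also have "\<dots> = ennreal (\<Prod>b\<in>E. u \<bullet> \<pi> b - l \<bullet> \<pi> b)"
    proof -
      have "0 \<le> u \<bullet> \<pi> \<theta> - l \<bullet> \<pi> \<theta>"
        using le[OF \<pi>_Basis[of \<theta>]] by (simp add: E_def)
      moreover have "(\<Prod>b\<in>E. u \<bullet> \<pi> b - l \<bullet> \<pi> b) = (u \<bullet> \<pi> \<theta> - l \<bullet> \<pi> \<theta>) * (\<Prod>b\<in>B. u \<bullet> \<pi> b - l \<bullet> \<pi> b)"
        using fin \<open>\<theta> \<notin> B\<close> by (simp add: E_def)
      ultimately show ?thesis
        by (simp only: ennreal_mult' mult.commute)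
    qed
    also have "(\<Prod>b\<in>E. u \<bullet> \<pi> b - l \<bullet> \<pi> b) = (\<Prod>i\<in>Basis. (u - l) \<bullet> i)"
      using prod.reindex_bij_betw[OF \<pi>, of "\<lambda>i. (u - l) \<bullet> i"] by (simp add: inner_diff_left)
    finally show "emeasure (distr ?N borel (\<lambda>(y, s). T (s *\<^sub>R \<theta> + y))) (box l u) = (\<Prod>b\<in>Basis. (u - l) \<bullet> b)" .
  qed simp
  then have "distr lborel borel R = distr (distr ?N borel (\<lambda>(y, s). T (s *\<^sub>R \<theta> + y))) borel R"
    by simp
  also have "\<dots> = distr ?N borel (R \<circ> (\<lambda>(y, s). T (s *\<^sub>R \<theta> + y)))"
    by (rule distr_distr) measurable
  also have "R \<circ> (\<lambda>(y, s). T (s *\<^sub>R \<theta> + y)) = (\<lambda>(y, s). s *\<^sub>R \<theta> + y)"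
    by (auto simp: RT)
  finally show ?thesis
    by (simp add: distr_lborel_orthogonal_transformation[OF \<open>orthogonal_transformation R\<close>])
qed

lemma AE_lborel_imp_AE_slices:
  fixes \<theta> :: "'a::euclidean_space"
  assumes "norm \<theta> = 1" and "AE x in lborel. P x"
  shows "AE y in hyperplane_lborel \<theta>. AE s in lborel. P (s *\<^sub>R \<theta> + y)"
proof -
  have "AE x in distr (hyperplane_lborel \<theta> \<Otimes>\<^sub>M lborel) borel (\<lambda>(y, s). s *\<^sub>R \<theta> + y). P x"
    using assms(2) by (simp only: lborel_eq_hyperplane_times_line[OF assms(1)])
  then have "AE z in hyperplane_lborel \<theta> \<Otimes>\<^sub>M lborel. P ((\<lambda>(y, s). s *\<^sub>R \<theta> + y) z)"
    by (rule AE_distrD[OF measurable_along_direction])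
  then obtain N where N: "{z \<in> space (hyperplane_lborel \<theta> \<Otimes>\<^sub>M lborel). \<not> P ((\<lambda>(y, s). s *\<^sub>R \<theta> + y) z)} \<subseteq> N"
    "emeasure (hyperplane_lborel \<theta> \<Otimes>\<^sub>M lborel) N = 0" "N \<in> sets (hyperplane_lborel \<theta> \<Otimes>\<^sub>M lborel)"
    by (rule AE_E)
  have "(\<integral>\<^sup>+y. emeasure lborel (Pair y -` N) \<partial>hyperplane_lborel \<theta>) = 0"
    using N(2,3) by (simp only: lborel.emeasure_pair_measure_alt)
  then have "AE y in hyperplane_lborel \<theta>. emeasure lborel (Pair y -` N) = 0"
    using N(3) by (subst (asm) nn_integral_0_iff_AE) (auto intro: lborel.measurable_emeasure_Pair)
  with AE_space show ?thesis
  proof eventually_elim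
    case (elim y)
    show "AE s in lborel. P (s *\<^sub>R \<theta> + y)"
    proof (rule AE_I)
      show "{s \<in> space lborel. \<not> P (s *\<^sub>R \<theta> + y)} \<subseteq> Pair y -` N"
        using elim(1) by (auto simp: space_pair_measure intro!: subsetD[OF N(1)])
      show "Pair y -` N \<in> sets lborel"
        using N(3) by (rule sets_Pair1)
    qed (rule elim(2))
  qed
qed

lemma AE_integrable_slices:
  fixes \<theta> :: "'a::euclidean_space" and f :: "'a \<Rightarrow> real"
  assumes \<theta>: "norm \<theta> = 1" and f: "integrable lborel f"
  shows "AE y in hyperplane_lborel \<theta>. integrable lborel (\<lambda>s. f (s *\<^sub>R \<theta> + y))"
proof -
  note [measurable] = measurable_along_direction[of \<theta>]
  have [measurable]: "f \<in> borel_measurable borel"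
    using f by auto
  let ?g = "\<lambda>z. ennreal (norm (f (case z of (y, s) \<Rightarrow> s *\<^sub>R \<theta> + y)))"
  have "(\<integral>\<^sup>+y. \<integral>\<^sup>+s. ?g (y, s) \<partial>lborel \<partial>hyperplane_lborel \<theta>) = (\<integral>\<^sup>+z. ?g z \<partial>(hyperplane_lborel \<theta> \<Otimes>\<^sub>M lborel))"
    by (rule lborel.nn_integral_fst) measurable
  also have "\<dots> = (\<integral>\<^sup>+x. ennreal (norm (f x)) \<partial>distr (hyperplane_lborel \<theta> \<Otimes>\<^sub>M lborel) borel (\<lambda>(y, s). s *\<^sub>R \<theta> + y))"
    by (subst nn_integral_distr) auto
  also have "\<dots> < \<infinity>"
    using f by (simp add: lborel_eq_hyperplane_times_line[OF \<theta>] integrable_iff_bounded)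
  finally have "(\<integral>\<^sup>+y. \<integral>\<^sup>+s. ?g (y, s) \<partial>lborel \<partial>hyperplane_lborel \<theta>) \<noteq> \<infinity>"
    by simp
  then have "AE y in hyperplane_lborel \<theta>. (\<integral>\<^sup>+s. ?g (y, s) \<partial>lborel) \<noteq> \<infinity>"
    by (rule nn_integral_PInf_AE[rotated]) measurable
  then show ?thesis
    by eventually_elim (simp add: integrable_iff_bounded less_top)
qed

section \<open>The directional trace\<close>

lemma L2_borel_representative:
  fixes f :: "'a::euclidean_space \<Rightarrow> real"
  assumes \<Omega> [measurable]: "\<Omega> \<in> sets borel" and f: "f \<in> L2 \<Omega>"
  shows "\<exists>f0. f0 \<in> borel_measurable borel \<and> (AE x in lebesgue_on \<Omega>. f0 x = f x) \<and>
    (\<forall>x. x \<notin> \<Omega> \<longrightarrow> f0 x = 0) \<and> integrable lborel (\<lambda>x. (f0 x)\<^sup>2)"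
proof -
  have f_meas: "f \<in> borel_measurable (lebesgue_on \<Omega>)" and f_int: "integrable (lebesgue_on \<Omega>) (\<lambda>x. (f x)\<^sup>2)"
    using f by (auto simp: L2_def)
  have "(\<lambda>x. indicator \<Omega> x * f x) \<in> borel_measurable (completion lborel)"
    using f_meas by (simp add: borel_measurable_restrict_space_iff)
  then obtain g where g: "g \<in> borel_measurable lborel" "AE x in lborel. indicator \<Omega> x * f x = g x"
    using completion_ex_borel_measurable_real by blast
  define f0 where "f0 x = indicator \<Omega> x * g x" for x
  have f0_meas [measurable]: "f0 \<in> borel_measurable borel"
    using g(1) unfolding f0_def by simp
  have "AE x in lborel. x \<in> \<Omega> \<longrightarrow> f0 x = f x"
    using g(2) by eventually_elim (auto simp: f0_def)
  then have eq: "AE x in lebesgue_on \<Omega>. f0 x = f x"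
    by (simp add: AE_restrict_space_iff AE_completion_iff)
  have "f0 \<in> borel_measurable (lebesgue_on \<Omega>)"
    by (intro measurable_restrict_space1 measurable_completion) simp
  then have "integrable (lebesgue_on \<Omega>) (\<lambda>x. (f0 x)\<^sup>2)"
    using f_int f_meas eq by (subst integrable_cong_AE[where g = "\<lambda>x. (f x)\<^sup>2"]) (auto elim: eventually_mono)
  then have "integrable lborel (\<lambda>x. indicator \<Omega> x * (f0 x)\<^sup>2)"
    by (subst (asm) integrable_lebesgue_on_borel) auto
  moreover have "(\<lambda>x. indicator \<Omega> x * (f0 x)\<^sup>2) = (\<lambda>x. (f0 x)\<^sup>2)"
    by (auto simp: f0_def fun_eq_iff indicator_def)
  ultimately have "integrable lborel (\<lambda>x. (f0 x)\<^sup>2)"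
    by simp
  moreover have "\<forall>x. x \<notin> \<Omega> \<longrightarrow> f0 x = 0"
    by (simp add: f0_def)
  ultimately show ?thesis
    using f0_meas eq by blast
qed

text \<open>
  The bound \<open>\<bar>a\<bar> \<le> 1 + a\<^sup>2\<close>, with the constant \<open>1\<close> integrable on a bounded set.
\<close>

lemma integrable_if_square_integrable_on_bounded:
  fixes f :: "'a::euclidean_space \<Rightarrow> real"
  assumes "\<Omega> \<in> sets borel" "bounded \<Omega>" and f: "f \<in> borel_measurable borel"
    and zero: "\<And>x. x \<notin> \<Omega> \<Longrightarrow> f x = 0" and sq: "integrable lborel (\<lambda>x. (f x)\<^sup>2)"
  shows "integrable lborel f"
proof (rule Bochner_Integration.integrable_bound)
  have "integrable lborel (indicator \<Omega> :: 'a \<Rightarrow> real)"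
    using assms(1) emeasure_bounded_finite[OF assms(2)] by (intro integrable_real_indicator) auto
  then show "integrable lborel (\<lambda>x. indicator \<Omega> x + (f x)\<^sup>2)"
    using sq by (rule Bochner_Integration.integrable_add)
  have bound: "\<bar>a\<bar> \<le> 1 + a\<^sup>2" for a :: real
  proof -
    have "0 \<le> (\<bar>a\<bar> - 1)\<^sup>2" by simp
    then have "2 * \<bar>a\<bar> \<le> 1 + a\<^sup>2" by (simp add: power2_eq_square algebra_simps)
    then show ?thesis by linarith
  qed
  show "AE x in lborel. norm (f x) \<le> norm (indicator \<Omega> x + (f x)\<^sup>2)"
  proof (rule AE_I2)
    fix x show "norm (f x) \<le> norm (indicator \<Omega> x + (f x)\<^sup>2)"
      using bound[of "f x"] zero[of x] by (cases "x \<in> \<Omega>") auto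
  qed
qed (use f in simp)

text \<open>
  The averages extend over intervals of length \<open>1 / (n + 1)\<close> to the left of \<open>\<beta>\<close>. They ignore null
  sets and eventually see only \<open>{\<alpha><..<\<beta>}\<close>, so they recover the continuous representative at \<open>\<beta>\<close>
  from any representative.
\<close>

lemma averages_tendsto_left_endpoint:
  fixes u w :: "real \<Rightarrow> real"
  assumes [measurable]: "u \<in> borel_measurable borel" and w: "continuous_on UNIV w" and "\<alpha> < \<beta>"
    and eq: "AE s in lborel. s \<in> {\<alpha><..<\<beta>} \<longrightarrow> u s = w s"
  shows "(\<lambda>n. \<integral>t. indicator {0..1} t * u (\<beta> - t / real (Suc n)) \<partial>lborel) \<longlonglongrightarrow> w \<beta>"
proof -
  have [measurable]: "w \<in> borel_measurable borel"
    using w by (rule borel_measurable_continuous_onI)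
  have isCont: "isCont w \<beta>"
    using w by (simp add: continuous_on_eq_continuous_at)
  have "compact (w ` {\<beta> - 1..\<beta>})"
    by (intro compact_continuous_image continuous_on_subset[OF w]) auto
  then obtain C where C: "\<And>s. s \<in> {\<beta> - 1..\<beta>} \<Longrightarrow> \<bar>w s\<bar> \<le> C"
    using compact_imp_bounded by (force simp: bounded_iff)
  have "(\<lambda>n. \<integral>t. indicator {0..1} t * w (\<beta> - t / real (Suc n)) \<partial>lborel)
      \<longlonglongrightarrow> (\<integral>t. indicator {0..1::real} t * w \<beta> \<partial>lborel)"
  proof (rule integral_dominated_convergence[where w = "\<lambda>t. indicator {0..1::real} t * C"])
    show "integrable lborel (\<lambda>t. indicator {0..1::real} t * C)"
      by (intro integrable_mult_left integrable_real_indicator) auto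
    have "(\<lambda>n. t / real (Suc n)) \<longlonglongrightarrow> 0" for t
      using tendsto_mult[OF tendsto_const LIMSEQ_inverse_real_of_nat, of t] by (simp add: divide_inverse)
    then have "(\<lambda>n. \<beta> - t / real (Suc n)) \<longlonglongrightarrow> \<beta> - 0" for t
      by (intro tendsto_intros)
    then have "(\<lambda>n. w (\<beta> - t / real (Suc n))) \<longlonglongrightarrow> w \<beta>" for t
      by (intro isCont_tendsto_compose[OF isCont]) simp
    then show "AE t in lborel. (\<lambda>n. indicator {0..1} t * w (\<beta> - t / real (Suc n)))
        \<longlonglongrightarrow> indicator {0..1} t * w \<beta>"
      by (intro AE_I2 tendsto_intros)
    show "AE t in lborel. norm (indicator {0..1} t * w (\<beta> - t / real (Suc n))) \<le> indicator {0..1} t * C" for n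
    proof (rule AE_I2)
      fix t :: real
      have "t / real (Suc n) \<le> 1" "0 \<le> t / real (Suc n)" if "t \<in> {0..1}"
        using that by (auto simp: divide_le_eq)
      then show "norm (indicator {0..1} t * w (\<beta> - t / real (Suc n))) \<le> indicator {0..1} t * C"
        using C by (auto simp: indicator_def)
    qed
  qed measurable
  moreover have "\<forall>\<^sub>F n in sequentially. (\<integral>t. indicator {0..1} t * w (\<beta> - t / real (Suc n)) \<partial>lborel)
      = (\<integral>t. indicator {0..1} t * u (\<beta> - t / real (Suc n)) \<partial>lborel)"
  proof -
    have "\<forall>\<^sub>F n in sequentially. inverse (real (Suc n)) < \<beta> - \<alpha>"
      using \<open>\<alpha> < \<beta>\<close> by (intro order_tendstoD(2)[OF LIMSEQ_inverse_real_of_nat]) simp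
    then show ?thesis
    proof eventually_elim
      case (elim n)
      have "AE t in lborel. \<beta> + (- inverse (real (Suc n))) * t \<in> {\<alpha><..<\<beta>} \<longrightarrow>
          u (\<beta> + (- inverse (real (Suc n))) * t) = w (\<beta> + (- inverse (real (Suc n))) * t)"
        using eq by (intro AE_borel_affine) auto
      then have "AE t in lborel. indicator {0..1} t * w (\<beta> - t / real (Suc n))
          = indicator {0..1} t * u (\<beta> - t / real (Suc n))"
        using AE_lborel_singleton[of 0]
      proof eventually_elim
        case (elim t)
        show ?case
        proof (cases "t \<in> {0..1}")
          case True
          with elim(2) have t: "0 < t" "t \<le> 1" by auto
          then have "0 < t / real (Suc n)" "t / real (Suc n) \<le> inverse (real (Suc n))"
            using divide_right_mono[of t 1 "real (Suc n)"] by (simp_all add: inverse_eq_divide)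
          then have "\<beta> - t / real (Suc n) \<in> {\<alpha><..<\<beta>}"
            using \<open>inverse (real (Suc n)) < \<beta> - \<alpha>\<close> by auto
          then show ?thesis
            using elim(1) by (simp add: divide_inverse mult.commute)
        qed simp
      qed
      then show ?case
        by (intro integral_cong_AE) measurable
    qed
  qed
  ultimately show ?thesis
    by (auto intro: Lim_transform_eventually)
qed

lemma open_line_section:
  assumes "open \<Omega>"
  shows "open (line_section \<theta> \<Omega> y)"
proof -
  have "line_section \<theta> \<Omega> y = (\<lambda>s. s *\<^sub>R \<theta> + y) -` \<Omega>"
    by (auto simp: line_section_def)
  then show ?thesis
    using assms by (simp only:) (intro open_vimage continuous_intros)
qed

lemma slice_representation:
  fixes u v :: "'a::euclidean_space \<Rightarrow> real"
  assumes "open \<Omega>" and v: "integrable lborel (\<lambda>s. v (s *\<^sub>R \<theta> + y))"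
    and diff: "AE s in lborel. AE h in lborel. (\<forall>t\<in>{0..1}. (s *\<^sub>R \<theta> + y) + (t * h) *\<^sub>R \<theta> \<in> \<Omega>) \<longrightarrow>
       u ((s *\<^sub>R \<theta> + y) + h *\<^sub>R \<theta>) - u (s *\<^sub>R \<theta> + y)
         = h * (\<integral>t. indicator {0..1} t * v ((s *\<^sub>R \<theta> + y) + (t * h) *\<^sub>R \<theta>) \<partial>lborel)"
  shows "\<exists>\<kappa>. AE s in lborel. s \<in> line_section \<theta> \<Omega> y \<longrightarrow> u (s *\<^sub>R \<theta> + y)
     = primitive (\<lambda>s. v (s *\<^sub>R \<theta> + y)) s + \<kappa> (connected_component_set (line_section \<theta> \<Omega> y) s)"
proof (rule AE_eq_primitive_plus_locally_constant[OF v open_line_section[OF \<open>open \<Omega>\<close>]])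
  have shift: "(s *\<^sub>R \<theta> + y) + r *\<^sub>R \<theta> = (s + r) *\<^sub>R \<theta> + y" for s r :: real
    by (simp add: scaleR_add_left)
  show "AE s in lborel. AE h in lborel. (\<forall>t\<in>{0..1}. s + t * h \<in> line_section \<theta> \<Omega> y) \<longrightarrow>
       u ((s + h) *\<^sub>R \<theta> + y) - u (s *\<^sub>R \<theta> + y)
         = h * (\<integral>t. indicator {0..1} t * v ((s + t * h) *\<^sub>R \<theta> + y) \<partial>lborel)"
    using diff unfolding shift line_section_def mem_Collect_eq .
qed

theorem theorem2p3:
  fixes \<Omega> :: "(real ^ 'n) set" and \<theta> :: "real ^ 'n" and u :: "real ^ 'n \<Rightarrow> real"
  assumes "open \<Omega>" and "bounded \<Omega>" and "\<theta> \<in> sphere 0 1" and "u \<in> W_dir \<theta> \<Omega>"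
  shows "\<exists>g. directional_trace \<theta> \<Omega> u g \<and>
             g \<in> borel_measurable (restrict_space borel (closure \<Omega> - \<Omega>))"
proof -
  have \<theta>: "norm \<theta> = 1" and \<Omega> [measurable]: "\<Omega> \<in> sets borel"
    using assms by auto
  obtain v where u: "u \<in> L2 \<Omega>" and v: "v \<in> L2 \<Omega>" and weak: "weak_dir_deriv \<Omega> \<theta> u v"
    using assms(4) by (auto simp: W_dir_def)
  obtain u0 where u0: "u0 \<in> borel_measurable borel" "AE x in lebesgue_on \<Omega>. u0 x = u x"
    "\<forall>x. x \<notin> \<Omega> \<longrightarrow> u0 x = 0" "integrable lborel (\<lambda>x. (u0 x)\<^sup>2)"
    using L2_borel_representative[OF \<Omega> u] by blast
  obtain v0 where v0: "v0 \<in> borel_measurable borel" "AE x in lebesgue_on \<Omega>. v0 x = v x"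
    "\<forall>x. x \<notin> \<Omega> \<longrightarrow> v0 x = 0" "integrable lborel (\<lambda>x. (v0 x)\<^sup>2)"
    using L2_borel_representative[OF \<Omega> v] by blast
  note [measurable] = u0(1) v0(1)
  have int: "integrable lborel u0" "integrable lborel v0"
    using integrable_if_square_integrable_on_bounded[OF \<Omega> \<open>bounded \<Omega>\<close> u0(1) _ u0(4)]
      integrable_if_square_integrable_on_bounded[OF \<Omega> \<open>bounded \<Omega>\<close> v0(1) _ v0(4)] u0(3) v0(3)
    by presburger+

  have transfer: "(\<integral>x. f x * \<psi> x \<partial>lebesgue_on \<Omega>) = (\<integral>x. f0 x * \<psi> x \<partial>lborel)"
    if f: "f \<in> L2 \<Omega>" and f0: "f0 \<in> borel_measurable borel" "AE x in lebesgue_on \<Omega>. f0 x = f x"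
      "\<forall>x. x \<notin> \<Omega> \<longrightarrow> f0 x = 0" and \<psi>: "continuous_on UNIV \<psi>" for f f0 \<psi> :: "real ^ 'n \<Rightarrow> real"
  proof -
    have \<psi>_meas: "\<psi> \<in> borel_measurable borel"
      using \<psi> by (rule borel_measurable_continuous_onI)
    have meas: "h \<in> borel_measurable (lebesgue_on \<Omega>)" if "h \<in> borel_measurable borel" for h :: "real ^ 'n \<Rightarrow> real"
      using that by (intro measurable_restrict_space1 measurable_completion) simp
    have "(\<integral>x. f x * \<psi> x \<partial>lebesgue_on \<Omega>) = (\<integral>x. f0 x * \<psi> x \<partial>lebesgue_on \<Omega>)"
      using f meas[OF \<psi>_meas] meas[OF f0(1)] f0(2)
      by (intro integral_cong_AE) (auto simp: L2_def elim: eventually_mono)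
    also have "\<dots> = (\<integral>x. indicator \<Omega> x * (f0 x * \<psi> x) \<partial>lborel)"
      using f0(1) \<psi>_meas by (intro integral_lebesgue_on_borel) auto
    also have "\<dots> = (\<integral>x. f0 x * \<psi> x \<partial>lborel)"
      by (rule Bochner_Integration.integral_cong) (auto simp: indicator_def f0(3))
    finally show ?thesis .
  qed
  have weak0: "(\<integral>x. u0 x * (\<theta> \<bullet> gradient \<phi> x) \<partial>lborel) = - (\<integral>x. v0 x * \<phi> x \<partial>lborel)"
    if \<phi>: "\<phi> \<in> test_functions \<Omega>" for \<phi>
  proof -
    have C: "C_k (Suc 0) \<phi>"
      using \<phi> unfolding test_functions_def by blast
    show ?thesis
      using weak[unfolded weak_dir_deriv_def, rule_format, OF \<phi>]
        transfer[OF u u0(1,2,3) continuous_on_gradient[OF C]]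
        transfer[OF v v0(1,2,3) continuous_on_C_k[OF C]]
      by simp
  qed

  \<comment> \<open>These conditions hold on almost every line and say all about the slice that the trace requires.\<close>
  define good where "good y \<longleftrightarrow> integrable lborel (\<lambda>s. (u0 (s *\<^sub>R \<theta> + y))\<^sup>2) \<and>
    integrable lborel (\<lambda>s. (v0 (s *\<^sub>R \<theta> + y))\<^sup>2) \<and> integrable lborel (\<lambda>s. v0 (s *\<^sub>R \<theta> + y)) \<and>
    (\<exists>\<kappa>. AE s in lborel. s \<in> line_section \<theta> \<Omega> y \<longrightarrow> u0 (s *\<^sub>R \<theta> + y)
      = primitive (\<lambda>s. v0 (s *\<^sub>R \<theta> + y)) s + \<kappa> (connected_component_set (line_section \<theta> \<Omega> y) s))" for y
  have "AE x in lborel. AE h in lborel. (\<forall>t\<in>{0..1}. x + (t * h) *\<^sub>R \<theta> \<in> \<Omega>) \<longrightarrow>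
     u0 (x + h *\<^sub>R \<theta>) - u0 x = h * (\<integral>t. indicator {0..1} t * v0 (x + (t * h) *\<^sub>R \<theta>) \<partial>lborel)"
    by (rule AE_AE_difference_eq_integral_of_weak_derivative[OF int \<open>open \<Omega>\<close> weak0])
  note diff = AE_lborel_imp_AE_slices[OF \<theta> this]
  have "AE y in hyperplane_lborel \<theta>. good y"
    using AE_integrable_slices[OF \<theta> u0(4)] AE_integrable_slices[OF \<theta> v0(4)] AE_integrable_slices[OF \<theta> int(2)] diff
  proof eventually_elim
    case (elim y)
    then show ?case
      unfolding good_def using slice_representation[OF \<open>open \<Omega>\<close> elim(3,4)] by blast
  qed
  then obtain N where N: "{y \<in> space (hyperplane_lborel \<theta>). \<not> good y} \<subseteq> N"
      "N \<in> null_sets (hyperplane_lborel \<theta>)"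
    by (auto simp: eventually_ae_filter)
  define A where "A = {y \<in> hyp_proj \<theta> ` \<Omega>. good y}"
  have "hyp_proj \<theta> x \<in> hyperplane \<theta>" for x
    using \<theta> by (simp add: hyp_proj_def hyperplane_def inner_diff_left norm_eq_1)
  then have "hyp_proj \<theta> ` \<Omega> - A \<subseteq> N"
    using N(1) by (auto simp: A_def)
  then have null: "hyp_proj \<theta> ` \<Omega> - A \<in> null_sets (hyperplane_lebesgue \<theta>)"
    unfolding hyperplane_lebesgue_def using N(2)
    by (intro null_sets_completion_subset[OF _ null_sets_completionI])

  \<comment> \<open>This formula mentions neither the components nor the exceptional lines, so it defines a Borel
    function on the whole space; the directional trace concerns only points where the averages converge.\<close>
  define g where "g x = lim (\<lambda>n. \<integral>t. indicator {0..1} t * u0 (x - (t / real (Suc n)) *\<^sub>R \<theta>) \<partial>lborel)" for x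
  have "g \<in> borel_measurable borel"
    unfolding g_def by (intro borel_measurable_lim_metric) measurable
  then have g_meas: "g \<in> borel_measurable (restrict_space borel (closure \<Omega> - \<Omega>))"
    by (rule measurable_restrict_space1)

  have slices: "(\<lambda>s. u0 (s *\<^sub>R \<theta> + y)) \<in> H1 (line_section \<theta> \<Omega> y) \<and>
     (\<forall>\<alpha> \<beta>. {\<alpha><..<\<beta>} \<in> components (line_section \<theta> \<Omega> y) \<longrightarrow>
        (\<exists>w. continuous_on {\<alpha><..\<beta>} w \<and>
             (AE s in lebesgue_on {\<alpha><..<\<beta>}. w s = u0 (s *\<^sub>R \<theta> + y)) \<and> g (\<beta> *\<^sub>R \<theta> + y) = w \<beta>))"
    if y: "y \<in> A" for y
  proof -
    define S where "S = line_section \<theta> \<Omega> y"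
    define U where "U s = u0 (s *\<^sub>R \<theta> + y)" for s
    define V where "V s = v0 (s *\<^sub>R \<theta> + y)" for s
    have S: "open S"
      unfolding S_def using \<open>open \<Omega>\<close> by (rule open_line_section)
    have [measurable]: "U \<in> borel_measurable borel" "V \<in> borel_measurable borel"
      unfolding U_def V_def by measurable
    obtain \<kappa> where \<kappa>: "AE s in lborel. s \<in> S \<longrightarrow> U s = primitive V s + \<kappa> (connected_component_set S s)"
      and UV: "integrable lborel (\<lambda>s. (U s)\<^sup>2)" "integrable lborel (\<lambda>s. (V s)\<^sup>2)" "integrable lborel V"
      using y unfolding A_def good_def S_def U_def V_def by blast
    have zero: "U s = 0" "V s = 0" if "s \<notin> S" for s
      using that u0(3) v0(3) by (simp_all add: S_def U_def V_def line_section_def)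
    have L2: "U \<in> L2 S" "V \<in> L2 S"
    proof -
      have "(\<lambda>s. indicator S s * (U s)\<^sup>2) = (\<lambda>s. (U s)\<^sup>2)" "(\<lambda>s. indicator S s * (V s)\<^sup>2) = (\<lambda>s. (V s)\<^sup>2)"
        using zero by (auto simp: fun_eq_iff indicator_def)
      then show "U \<in> L2 S" "V \<in> L2 S"
        using S UV by (simp_all add: L2_borel_iff)
    qed
    have "weak_dir_deriv S 1 U V"
      by (rule weak_derivative_primitive_plus_locally_constant[OF _ UV(3) S \<kappa>]) simp
    with L2 have "U \<in> H1 S"
      by (auto simp: H1_def)
    moreover have "\<exists>w. continuous_on {\<alpha><..\<beta>} w \<and>
        (AE s in lebesgue_on {\<alpha><..<\<beta>}. w s = U s) \<and> g (\<beta> *\<^sub>R \<theta> + y) = w \<beta>"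
      if I: "{\<alpha><..<\<beta>} \<in> components S" for \<alpha> \<beta>
    proof -
      \<comment> \<open>The representative that is continuous up to \<open>\<beta>\<close> (in fact on the whole line).\<close>
      define w where "w s = primitive V s + \<kappa> {\<alpha><..<\<beta>}" for s
      have w: "continuous_on UNIV w"
        unfolding w_def by (intro continuous_intros continuous_on_primitive UV)
      have "\<alpha> < \<beta>"
        using in_components_nonempty[OF I] by simp
      have comp: "connected_component_set S s = {\<alpha><..<\<beta>}" "s \<in> S" if "s \<in> {\<alpha><..<\<beta>}" for s
      proof -
        obtain x where "{\<alpha><..<\<beta>} = connected_component_set S x"
          using I by (auto simp: components_def)
        then show "connected_component_set S s = {\<alpha><..<\<beta>}"
          using connected_component_eq[of s S x] that by simp
        show "s \<in> S"
          using in_components_subset[OF I] that by blast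
      qed
      have eq: "AE s in lborel. s \<in> {\<alpha><..<\<beta>} \<longrightarrow> U s = w s"
        using \<kappa> by eventually_elim (simp add: comp w_def del: greaterThanLessThan_iff)
      then have w_eq: "AE s in lebesgue_on {\<alpha><..<\<beta>}. w s = U s"
        by (auto simp: AE_restrict_space_iff AE_completion_iff elim: eventually_mono)
      have shift: "(\<beta> *\<^sub>R \<theta> + y) - r *\<^sub>R \<theta> = (\<beta> - r) *\<^sub>R \<theta> + y" for r
        by (simp add: scaleR_diff_left)
      have "g (\<beta> *\<^sub>R \<theta> + y) = lim (\<lambda>n. \<integral>t. indicator {0..1} t * U (\<beta> - t / real (Suc n)) \<partial>lborel)"
        unfolding g_def U_def shift ..
      also have "\<dots> = w \<beta>"
        by (rule limI[OF averages_tendsto_left_endpoint[OF _ w \<open>\<alpha> < \<beta>\<close> eq]]) measurable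
      finally have "g (\<beta> *\<^sub>R \<theta> + y) = w \<beta>" .
      with w_eq show ?thesis
        using continuous_on_subset[OF w] by blast
    qed
    ultimately show ?thesis
      unfolding S_def U_def by blast
  qed
  have "u0 \<in> L2 \<Omega>"
  proof -
    have "(\<lambda>x. indicator \<Omega> x * (u0 x)\<^sup>2) = (\<lambda>x. (u0 x)\<^sup>2)"
      using u0(3) by (auto simp: fun_eq_iff indicator_def)
    then show ?thesis
      using u0(4) by (simp add: L2_borel_iff)
  qed
  moreover have "A \<subseteq> hyp_proj \<theta> ` \<Omega>"
    by (auto simp: A_def)
  ultimately have "directional_trace \<theta> \<Omega> u g"
    unfolding directional_trace_def using u0(2) null slices by blast
  with g_meas show ?thesis by blast
qed

end
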